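(* For every group $G$, the Johnson homomorphism $J\colon\mathrm{gr}_F(\mathcal{T}_G)\to\mathrm{Der}(\mathrm{gr}_\Gamma(G))$ is equivariant with respect to the natural actions of $\mathcal{A}(G)$ on source and target.
   Context: For a group $G$, $(x,y)=xyx^{-1}y^{-1}$, $\Gamma^1(G)=G$, $\Gamma^{s+1}(G)=(\Gamma^s(G),G)$, and $\mathrm{gr}_\Gamma(G)=\bigoplus_{s\ge1}\Gamma^s(G)/\Gamma^{s+1}(G)$ is the associated graded Lie algebra (over $\mathbb{Z}$), with bracket induced by the commutator. The Johnson filtration on $\mathrm{Aut}(G)$ (product = composition) is $F^s=\{\alpha\mid\alpha(x)x^{-1}\in\Gamma^{s+1}(G)\ \forall x\in G\}$, $s\ge0$; $(F^s,F^t)\subseteq F^{s+t}$. The Torelli group is $\mathcal{T}_G=F^1$, and $\mathrm{gr}_F(\mathcal{T}_G)=\bigoplus_{s\ge1}F^s/F^{s+1}$ is a graded Lie algebra. For a graded Lie algebra $\mathfrak{g}$, $\mathrm{Der}(\mathfrak{g})=\bigoplus_{s\ge1}\mathrm{Der}^s(\mathfrak{g})$, with $\mathrm{Der}^s(\mathfrak{g})$ the linear derivations raising degree by $s$. The Johnson homomorphism is the (well-defined, injective) morphism of graded Lie algebras $J(\bar\alpha)(\bar x)=\overline{\alpha(x)x^{-1}}\in\mathrm{gr}_\Gamma^{s+t}(G)$ for $\alpha\in F^s$, $s\ge 1$, $x\in\Gamma^t(G)$. $\mathcal{A}(G)=F^0/F^1=\mathrm{im}(\mathrm{Aut}(G)\to\mathrm{Aut}(G_{\mathrm{ab}}))$.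 For $\bar\sigma\in\mathcal{A}(G)$ represented by $\sigma\in\mathrm{Aut}(G)$: $\bar\sigma$ acts on $\mathrm{gr}_F(\mathcal{T}_G)$ by $\bar\sigma\cdot\bar\alpha=\overline{\sigma\alpha\sigma^{-1}}$, on $\mathrm{gr}_\Gamma(G)$ by $\bar\sigma\cdot\bar x=\overline{\sigma(x)}$, and on $\mathrm{Der}(\mathrm{gr}_\Gamma(G))$ by $\bar\sigma\cdot\delta=\bar\sigma\delta\bar\sigma^{-1}$; these are well defined. *)

theory Defs
  imports
    "HOL-Algebra.Bij"
    "HOL-Algebra.FiniteProduct"
    "HOL-Algebra.Generated_Groups"
    "HOL-Algebra.Product_Groups"
    "HOL-Algebra.Group_Action"
begin

section \<open>Commutators and the lower central series\<close>

definition commutator :: "('a, 'b) monoid_scheme \<Rightarrow> 'a \<Rightarrow> 'a \<Rightarrow> 'a" where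
  "commutator G x y = x \<otimes>\<^bsub>G\<^esub> y \<otimes>\<^bsub>G\<^esub> inv\<^bsub>G\<^esub> x \<otimes>\<^bsub>G\<^esub> inv\<^bsub>G\<^esub> y"

definition commutator_subgroup :: "('a, 'b) monoid_scheme \<Rightarrow> 'a set \<Rightarrow> 'a set \<Rightarrow> 'a set" where
  "commutator_subgroup G H K = generate G {commutator G x y | x y. x \<in> H \<and> y \<in> K}"

text \<open>The series starts in degree 1; the value in degree 0 is a dummy.\<close>

fun lower_central :: "('a, 'b) monoid_scheme \<Rightarrow> nat \<Rightarrow> 'a set" where
  "lower_central G 0 = carrier G"
| "lower_central G (Suc 0) = carrier G"
| "lower_central G (Suc (Suc n)) = commutator_subgroup G (lower_central G (Suc n)) (carrier G)"


section \<open>Graded Lie algebras over the integers\<close>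

text \<open>The underlying abelian group of a Lie algebra is written multiplicatively, as it comes
  from \<^const>\<open>FactGroup\<close> and \<^const>\<open>sum_group\<close>: \<^const>\<open>mult\<close> is the addition
  of the Lie algebra and \<^const>\<open>one\<close> its zero. Linear maps over the integers are the
  elements of \<^const>\<open>hom\<close>. The field \<open>component\<close> gives the homogeneous
  components; only the degrees from 1 on are relevant.\<close>

record 'a graded_lie = "'a monoid" +
  lie_bracket :: "'a \<Rightarrow> 'a \<Rightarrow> 'a"
  component :: "nat \<Rightarrow> 'a set"

subsection \<open>The graded Lie algebra of a filtration\<close>

definition gr_piece :: "('a, 'b) monoid_scheme \<Rightarrow> (nat \<Rightarrow> 'a set) \<Rightarrow> nat \<Rightarrow> 'a set monoid" where
  "gr_piece G K s = (G\<lparr>carrier := K s\<rparr>) Mod (K (Suc s))"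

text \<open>Here and below, a map on cosets that is induced by a map on representatives is given as
  \<^const>\<open>the_elem\<close> of the set of all values obtained from representatives. This set is a
  singleton whenever the induced map is well defined.\<close>

definition gr_piece_bracket ::
    "('a, 'b) monoid_scheme \<Rightarrow> (nat \<Rightarrow> 'a set) \<Rightarrow> nat \<Rightarrow> nat \<Rightarrow> 'a set \<Rightarrow> 'a set \<Rightarrow> 'a set" where
  "gr_piece_bracket G K i j A B =
     the_elem ((\<lambda>(x, y). K (Suc (i + j)) #>\<^bsub>G\<^esub> commutator G x y) ` (A \<times> B))"

definition gr_sum :: "('a, 'b) monoid_scheme \<Rightarrow> (nat \<Rightarrow> 'a set) \<Rightarrow> (nat \<Rightarrow> 'a set) monoid" where
  "gr_sum G K = sum_group {1..} (gr_piece G K)"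

definition gr :: "('a, 'b) monoid_scheme \<Rightarrow> (nat \<Rightarrow> 'a set) \<Rightarrow> (nat \<Rightarrow> 'a set) graded_lie" where
  "gr G K =
     \<lparr>carrier = carrier (gr_sum G K),
      mult = mult (gr_sum G K),
      one = one (gr_sum G K),
      lie_bracket = (\<lambda>x y. \<lambda>r\<in>{1..}.
        finprod (gr_piece G K r) (\<lambda>i. gr_piece_bracket G K i (r - i) (x i) (y (r - i))) {1..<r}),
      component = (\<lambda>s. {x \<in> carrier (gr_sum G K).
        \<forall>i\<in>{1..}. i \<noteq> s \<longrightarrow> x i = \<one>\<^bsub>gr_piece G K i\<^esub>})\<rparr>"

subsection \<open>Derivations\<close>

definition der_carrier :: "('a, 'b) graded_lie_scheme \<Rightarrow> nat \<Rightarrow> ('a \<Rightarrow> 'a) set" where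
  "der_carrier L s =
     {\<delta> \<in> hom L L \<inter> extensional (carrier L).
        (\<forall>t\<ge>1. \<forall>x\<in>component L t. \<delta> x \<in> component L (t + s)) \<and>
        (\<forall>x\<in>carrier L. \<forall>y\<in>carrier L.
           \<delta> (lie_bracket L x y) = lie_bracket L (\<delta> x) y \<otimes>\<^bsub>L\<^esub> lie_bracket L x (\<delta> y))}"

definition der_piece :: "('a, 'b) graded_lie_scheme \<Rightarrow> nat \<Rightarrow> ('a \<Rightarrow> 'a) monoid" where
  "der_piece L s =
     \<lparr>carrier = der_carrier L s,
      mult = (\<lambda>\<delta> \<epsilon>. \<lambda>x\<in>carrier L. \<delta> x \<otimes>\<^bsub>L\<^esub> \<epsilon> x),
      one = (\<lambda>x\<in>carrier L. \<one>\<^bsub>L\<^esub>)\<rparr>"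

definition Der :: "('a, 'b) graded_lie_scheme \<Rightarrow> (nat \<Rightarrow> 'a \<Rightarrow> 'a) monoid" where
  "Der L = sum_group {1..} (der_piece L)"


section \<open>The Johnson filtration and the Torelli group\<close>

definition johnson_filtration :: "('a, 'b) monoid_scheme \<Rightarrow> nat \<Rightarrow> ('a \<Rightarrow> 'a) set" where
  "johnson_filtration G s =
     {\<alpha> \<in> carrier (AutoGroup G).
        \<forall>x\<in>carrier G. \<alpha> x \<otimes>\<^bsub>G\<^esub> inv\<^bsub>G\<^esub> x \<in> lower_central G (Suc s)}"

definition torelli_group :: "('a, 'b) monoid_scheme \<Rightarrow> ('a \<Rightarrow> 'a) monoid" where
  "torelli_group G = (AutoGroup G)\<lparr>carrier := johnson_filtration G 1\<rparr>"

definition gr_Gamma :: "('a, 'b) monoid_scheme \<Rightarrow> (nat \<Rightarrow> 'a set) graded_lie" where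
  "gr_Gamma G = gr G (lower_central G)"

definition gr_Torelli :: "('a, 'b) monoid_scheme \<Rightarrow> (nat \<Rightarrow> ('a \<Rightarrow> 'a) set) graded_lie" where
  "gr_Torelli G = gr (torelli_group G) (johnson_filtration G)"


section \<open>The Johnson homomorphism\<close>

definition johnson_piece ::
    "('a, 'b) monoid_scheme \<Rightarrow> nat \<Rightarrow> nat \<Rightarrow> ('a \<Rightarrow> 'a) set \<Rightarrow> 'a set \<Rightarrow> 'a set" where
  "johnson_piece G s t A X =
     the_elem ((\<lambda>(\<alpha>, x). lower_central G (Suc (s + t)) #>\<^bsub>G\<^esub> (\<alpha> x \<otimes>\<^bsub>G\<^esub> inv\<^bsub>G\<^esub> x)) ` (A \<times> X))"

text \<open>The derivation of degree \<open>s\<close> attached to a coset in degree \<open>s\<close>, extended linearly to all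
  of the graded Lie algebra: the degree \<open>r\<close> part of the value comes from degree \<open>r - s\<close>.\<close>

definition johnson_degree ::
    "('a, 'b) monoid_scheme \<Rightarrow> nat \<Rightarrow> ('a \<Rightarrow> 'a) set \<Rightarrow> (nat \<Rightarrow> 'a set) \<Rightarrow> (nat \<Rightarrow> 'a set)" where
  "johnson_degree G s A =
     (\<lambda>x\<in>carrier (gr_Gamma G). \<lambda>r\<in>{1..}.
        if s < r then johnson_piece G s (r - s) A (x (r - s))
        else \<one>\<^bsub>gr_piece G (lower_central G) r\<^esub>)"

definition johnson ::
    "('a, 'b) monoid_scheme \<Rightarrow>
     (nat \<Rightarrow> ('a \<Rightarrow> 'a) set) \<Rightarrow> (nat \<Rightarrow> (nat \<Rightarrow> 'a set) \<Rightarrow> (nat \<Rightarrow> 'a set))" where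
  "johnson G = (\<lambda>a\<in>carrier (gr_Torelli G). \<lambda>s\<in>{1..}. johnson_degree G s (a s))"


section \<open>The natural actions\<close>

definition A_group :: "('a, 'b) monoid_scheme \<Rightarrow> ('a \<Rightarrow> 'a) set monoid" where
  "A_group G = gr_piece (AutoGroup G) (johnson_filtration G) 0"

definition act_Torelli ::
    "('a, 'b) monoid_scheme \<Rightarrow> ('a \<Rightarrow> 'a) set \<Rightarrow>
     (nat \<Rightarrow> ('a \<Rightarrow> 'a) set) \<Rightarrow> (nat \<Rightarrow> ('a \<Rightarrow> 'a) set)" where
  "act_Torelli G S =
     (\<lambda>a\<in>carrier (gr_Torelli G). \<lambda>s\<in>{1..}.
        the_elem ((\<lambda>(\<sigma>, \<alpha>). johnson_filtration G (Suc s) #>\<^bsub>AutoGroup G\<^esub>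
          (\<sigma> \<otimes>\<^bsub>AutoGroup G\<^esub> \<alpha> \<otimes>\<^bsub>AutoGroup G\<^esub> inv\<^bsub>AutoGroup G\<^esub> \<sigma>)) ` (S \<times> a s)))"

definition act_Gamma ::
    "('a, 'b) monoid_scheme \<Rightarrow> ('a \<Rightarrow> 'a) set \<Rightarrow> (nat \<Rightarrow> 'a set) \<Rightarrow> (nat \<Rightarrow> 'a set)" where
  "act_Gamma G S =
     (\<lambda>x\<in>carrier (gr_Gamma G). \<lambda>t\<in>{1..}.
        the_elem ((\<lambda>(\<sigma>, g). lower_central G (Suc t) #>\<^bsub>G\<^esub> \<sigma> g) ` (S \<times> x t)))"

definition act_Der ::
    "('a, 'b) monoid_scheme \<Rightarrow> ('a \<Rightarrow> 'a) set \<Rightarrow>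
     (nat \<Rightarrow> (nat \<Rightarrow> 'a set) \<Rightarrow> (nat \<Rightarrow> 'a set)) \<Rightarrow> (nat \<Rightarrow> (nat \<Rightarrow> 'a set) \<Rightarrow> (nat \<Rightarrow> 'a set))" where
  "act_Der G S =
     (\<lambda>\<delta>\<in>carrier (Der (gr_Gamma G)). \<lambda>s\<in>{1..}. \<lambda>x\<in>carrier (gr_Gamma G).
        act_Gamma G S (\<delta> s (act_Gamma G (inv\<^bsub>A_group G\<^esub> S) x)))"

definition equivariant_map ::
    "('g, 'h) monoid_scheme \<Rightarrow> 'a set \<Rightarrow> ('g \<Rightarrow> 'a \<Rightarrow> 'a) \<Rightarrow> 'b set \<Rightarrow> ('g \<Rightarrow> 'b \<Rightarrow> 'b) \<Rightarrow>
     ('a \<Rightarrow> 'b) \<Rightarrow> bool" where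
  "equivariant_map A X \<phi> Y \<psi> f \<longleftrightarrow>
     group_action A X \<phi> \<and> group_action A Y \<psi> \<and> f \<in> X \<rightarrow> Y \<and>
     (\<forall>g\<in>carrier A. \<forall>x\<in>X. f (\<phi> g x) = \<psi> g (f x))"

end

theory Submission
  imports Defs
begin

text \<open>Everything is computed on representatives. For \<open>\<alpha>\<close> in degree \<open>s\<close> of the Johnson filtration
  and \<open>x\<close> in degree \<open>t\<close> of the lower central series, \<open>\<sigma>\<alpha>\<sigma>\<^sup>-\<^sup>1(x) x\<^sup>-\<^sup>1 = \<sigma>(\<alpha>(y) y\<^sup>-\<^sup>1)\<close> with
  \<open>y = \<sigma>\<^sup>-\<^sup>1(x)\<close>, which is equivariance. What makes the representatives legitimate, and the Johnson
  map a derivation, is that \<open>\<alpha>(x) x\<^sup>-\<^sup>1\<close> lies in degree \<open>s + t\<close>: modulo degree \<open>s + i + j + 1\<close>, the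
  commutator of \<open>\<alpha>(x) = c x\<close> and \<open>\<alpha>(y) = d y\<close> is \<open>(c, y) (x, d) (x, y)\<close>.\<close>

section \<open>Automorphisms and the lower central series\<close>

text \<open>The obstacle is the degree s + t of \<alpha>(x) x^-1: the definition of F^s gives it
  only for t = 1. The proof is an induction on t, for one generator (y, z) at a time, modulo degree
  s + t + 1. There \<alpha>(y) y^-1 is central, while d = \<alpha>(z) z^-1, of degree s + 1, has to
  commute with everything of degree t. That is the same estimate at t once more, for conjugation by
  d, which lies in F^(s+1). Hence the estimate for automorphisms and the inclusions (Gamma^i,
  Gamma^j) in Gamma^(i+j) form a single induction. Well-definedness is a theorem at every stage,
  because an induced map is \<open>the_elem\<close> of a set of values: nothing can be computed
  before that set is known to be a singleton. For the two actions, independence of the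
  representative \<sigma> is the case s = 1 of an inclusion: of the estimate for
  \<open>gr_Gamma G\<close>, of (F^s, F^t) in F^(s+t) for \<open>gr_Torelli G\<close>. Most of the
  work goes into the other demands of \<open>equivariant_map\<close>: that there are group actions
  on both sides, and that the values of \<open>johnson G\<close> are finite sums of
  derivations.\<close>

lemma the_elem_image_pair:
  assumes "a \<in> A" "b \<in> B" "\<And>x y. \<lbrakk>x \<in> A; y \<in> B\<rbrakk> \<Longrightarrow> f x y = c"
  shows "the_elem ((\<lambda>(x, y). f x y) ` (A \<times> B)) = c"
proof -
  have "(\<lambda>(x, y). f x y) ` (A \<times> B) = {c}" using assms by force
  then show ?thesis by simp
qed

lemma (in normal) rcos_eq_iff:
  assumes "x \<in> carrier G" "y \<in> carrier G"
  shows "H #> x = H #> y \<longleftrightarrow> x \<otimes> inv y \<in> H"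
  by (metis assms is_group is_subgroup rcos_module rcos_self repr_independence)

context group
begin

lemma inv_cancel_left:
  assumes "x \<in> carrier G" "y \<in> carrier G"
  shows "inv x \<otimes> (x \<otimes> y) = y" "x \<otimes> (inv x \<otimes> y) = y"
  using assms by (simp_all flip: m_assoc)

text \<open>Simp set for word identities in a group: products reassociate to the right, inverses
  move onto the letters, and adjacent inverse pairs cancel even in the middle of a word.\<close>

lemmas group_normalize = m_assoc inv_mult_group inv_cancel_left

lemma commutator_closed [simp]:
  "\<lbrakk>x \<in> carrier G; y \<in> carrier G\<rbrakk> \<Longrightarrow> commutator G x y \<in> carrier G"
  by (simp add: commutator_def)

lemma commutator_eq_one_iff:
  assumes "x \<in> carrier G" "y \<in> carrier G"
  shows "commutator G x y = \<one> \<longleftrightarrow> x \<otimes> y = y \<otimes> x"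
proof -
  have "commutator G x y = x \<otimes> y \<otimes> inv (y \<otimes> x)"
    using assms by (simp add: commutator_def group_normalize)
  then show ?thesis
    using assms inv_solve_right' [of \<one> "x \<otimes> y" "y \<otimes> x"] by auto
qed

end

lemma (in group_hom) hom_commutator:
  "\<lbrakk>x \<in> carrier G; y \<in> carrier G\<rbrakk>
    \<Longrightarrow> h (commutator G x y) = commutator H (h x) (h y)"
  by (simp add: commutator_def)

context group
begin

lemma AutoGroup_carrier_iff:
  "\<alpha> \<in> carrier (AutoGroup G) \<longleftrightarrow> \<alpha> \<in> hom G G \<and> \<alpha> \<in> Bij (carrier G)"
  by (simp add: AutoGroup_def auto_def)

lemma AutoGroup_hom: "\<alpha> \<in> carrier (AutoGroup G) \<Longrightarrow> group_hom G G \<alpha>"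
  by (simp add: AutoGroup_carrier_iff group_hom_def group_hom_axioms_def is_group)

lemma AutoGroup_closed:
  "\<lbrakk>\<alpha> \<in> carrier (AutoGroup G); x \<in> carrier G\<rbrakk> \<Longrightarrow> \<alpha> x \<in> carrier G"
  by (rule group_hom.hom_closed [OF AutoGroup_hom])

lemma AutoGroup_mult:
  "\<lbrakk>\<alpha> \<in> carrier (AutoGroup G); x \<in> carrier G; y \<in> carrier G\<rbrakk> \<Longrightarrow> \<alpha> (x \<otimes> y) = \<alpha> x \<otimes> \<alpha> y"
  by (rule group_hom.hom_mult [OF AutoGroup_hom])

lemma AutoGroup_inv:
  "\<lbrakk>\<alpha> \<in> carrier (AutoGroup G); x \<in> carrier G\<rbrakk> \<Longrightarrow> \<alpha> (inv x) = inv (\<alpha> x)"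
  by (rule group_hom.hom_inv [OF AutoGroup_hom])

lemmas AutoGroup_commutator = group_hom.hom_commutator [OF AutoGroup_hom]

lemma AutoGroup_comp [simp]:
  "\<lbrakk>\<alpha> \<in> carrier (AutoGroup G); \<beta> \<in> carrier (AutoGroup G); x \<in> carrier G\<rbrakk>
    \<Longrightarrow> (\<alpha> \<otimes>\<^bsub>AutoGroup G\<^esub> \<beta>) x = \<alpha> (\<beta> x)"
  by (simp add: AutoGroup_def auto_def BijGroup_def compose_def)

lemma AutoGroup_one [simp]: "x \<in> carrier G \<Longrightarrow> \<one>\<^bsub>AutoGroup G\<^esub> x = x"
  by (simp add: AutoGroup_def BijGroup_def)

lemma AutoGroup_inv_closed [simp]:
  "\<alpha> \<in> carrier (AutoGroup G) \<Longrightarrow> inv\<^bsub>AutoGroup G\<^esub> \<alpha> \<in> carrier (AutoGroup G)"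
  using group.inv_closed [OF AutoGroup] .

lemma AutoGroup_inv_apply [simp]:
  assumes "\<alpha> \<in> carrier (AutoGroup G)" "x \<in> carrier G"
  shows "(inv\<^bsub>AutoGroup G\<^esub> \<alpha>) (\<alpha> x) = x" "\<alpha> ((inv\<^bsub>AutoGroup G\<^esub> \<alpha>) x) = x"
  using assms group.l_inv [OF AutoGroup, of \<alpha>] group.r_inv [OF AutoGroup, of \<alpha>]
  by (simp_all flip: AutoGroup_comp)

text \<open>The restriction to \<open>carrier G\<close> is forced, since elements of
  \<open>AutoGroup G\<close> are extensional. With inner automorphisms available, normality and
  commutator inclusions become instances of statements about automorphisms.\<close>

lemma conjugation_AutoGroup:
  assumes "d \<in> carrier G"
  shows "(\<lambda>x\<in>carrier G. d \<otimes> x \<otimes> inv d) \<in> carrier (AutoGroup G)"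
proof -
  have "bij_betw (\<lambda>x. d \<otimes> x \<otimes> inv d) (carrier G) (carrier G)"
  proof (rule bij_betwI [where g = "\<lambda>x. inv d \<otimes> x \<otimes> d"])
    fix x assume "x \<in> carrier G"
    with assms show "inv d \<otimes> (d \<otimes> x \<otimes> inv d) \<otimes> d = x" "d \<otimes> (inv d \<otimes> x \<otimes> d) \<otimes> inv d = x"
      by (simp_all add: group_normalize)
  qed (use assms in \<open>simp_all add: Pi_iff\<close>)
  moreover have "d \<otimes> (x \<otimes> y) \<otimes> inv d = d \<otimes> x \<otimes> inv d \<otimes> (d \<otimes> y \<otimes> inv d)"
    if "x \<in> carrier G" "y \<in> carrier G" for x y
    using assms that by (simp add: group_normalize)
  ultimately show ?thesis
    using assms by (simp add: AutoGroup_carrier_iff Bij_def hom_def Pi_iff)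
qed

section \<open>The lower central series is characteristic, normal and decreasing\<close>

lemma commutator_subgroup_subgroup:
  assumes "H \<subseteq> carrier G" "K \<subseteq> carrier G"
  shows "subgroup (commutator_subgroup G H K) G"
  unfolding commutator_subgroup_def
  by (rule generate_is_subgroup) (use assms in \<open>auto simp: subset_iff\<close>)

lemma lower_central_subgroup: "subgroup (lower_central G n) G"
proof (induction n)
  case 0
  then show ?case by (simp add: subgroup_self)
next
  case (Suc n)
  then show ?case
    by (cases n) (simp_all add: subgroup_self commutator_subgroup_subgroup subgroup.subset)
qed

lemmas lower_central_carrier = subgroup.mem_carrier [OF lower_central_subgroup]

text \<open>By induction \<alpha> maps the generating commutators of each term into generating
  commutators, and a homomorphism carries the subgroup generated by a set to the one generated by
  its image.\<close>

lemma AutoGroup_lower_central: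
  assumes \<alpha>: "\<alpha> \<in> carrier (AutoGroup G)"
  shows "x \<in> lower_central G n \<Longrightarrow> \<alpha> x \<in> lower_central G n"
proof (induction n arbitrary: x)
  case 0
  then show ?case using AutoGroup_closed [OF \<alpha>] by simp
next
  case (Suc n)
  show ?case
  proof (cases n)
    case 0
    then show ?thesis using Suc.prems AutoGroup_closed [OF \<alpha>] by simp
  next
    case (Suc m)
    let ?S = "{commutator G x y | x y. x \<in> lower_central G n \<and> y \<in> carrier G}"
    have S: "?S \<subseteq> carrier G"
      by (auto simp: lower_central_carrier)
    have eq: "lower_central G (Suc n) = generate G ?S"
      by (simp add: Suc commutator_subgroup_def)
    have "\<alpha> ` ?S \<subseteq> ?S"
      using Suc.IH AutoGroup_commutator [OF \<alpha>] AutoGroup_closed [OF \<alpha>]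
      by (auto simp: lower_central_carrier) blast
    then have "generate G (\<alpha> ` ?S) \<subseteq> generate G ?S"
      by (rule mono_generate)
    then show ?thesis
      using Suc.prems group_hom.generate_img [OF AutoGroup_hom [OF \<alpha>] S] unfolding eq by auto
  qed
qed

text \<open>Characteristic implies normal: normality is invariance under inner
  automorphisms.\<close>

lemma lower_central_normal: "lower_central G n \<lhd> G"
proof (rule normal_invI [OF lower_central_subgroup])
  fix x h assume "x \<in> carrier G" "h \<in> lower_central G n"
  then show "x \<otimes> h \<otimes> inv x \<in> lower_central G n"
    using AutoGroup_lower_central [OF conjugation_AutoGroup, of x h n]
    by (simp add: lower_central_carrier)
qed

lemma commutator_lower_central_carrier:
  assumes "x \<in> lower_central G (Suc n)" "y \<in> carrier G"
  shows "commutator G x y \<in> lower_central G (Suc (Suc n))"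
  using assms by (auto simp: commutator_subgroup_def intro!: generate.incl)

text \<open>A commutator (x, y) is x times a conjugate of x^-1, so it stays in any normal subgroup
  that contains x.\<close>

lemma lower_central_Suc: "lower_central G (Suc n) \<subseteq> lower_central G n"
proof (cases n)
  case (Suc m)
  have "commutator G x y \<in> lower_central G n" if "x \<in> lower_central G n" "y \<in> carrier G" for x y
  proof -
    have "commutator G x y = x \<otimes> (y \<otimes> inv x \<otimes> inv y)"
      using that by (simp add: commutator_def group_normalize lower_central_carrier)
    then show ?thesis
      using that normal_invE [OF lower_central_normal] lower_central_subgroup
      by (simp add: subgroup.m_closed subgroup.m_inv_closed)
  qed
  then show ?thesis
    unfolding Suc lower_central.simps commutator_subgroup_def
    by (intro generate_subgroup_incl) (auto simp: lower_central_subgroup)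
qed simp

section \<open>The Johnson filtration acting on the lower central series\<close>

lemma johnson_filtrationD:
  assumes "\<alpha> \<in> johnson_filtration G s"
  shows "\<alpha> \<in> carrier (AutoGroup G)"
    and "x \<in> carrier G \<Longrightarrow> \<alpha> x \<otimes> inv x \<in> lower_central G (Suc s)"
  using assms by (auto simp: johnson_filtration_def)

text \<open>For conjugation by d the defining element \<alpha>(x) x^-1 is the commutator (d, x), one
  degree deeper than d. The indices match without a shift: degree \<open>Suc s\<close> of the lower
  central series goes to step \<open>Suc s\<close> of the Johnson filtration.\<close>

lemma conjugation_johnson_filtration:
  assumes "d \<in> lower_central G (Suc s)"
  shows "(\<lambda>x\<in>carrier G. d \<otimes> x \<otimes> inv d) \<in> johnson_filtration G (Suc s)"
  using assms commutator_lower_central_carrier [OF assms]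
  by (auto simp: johnson_filtration_def conjugation_AutoGroup lower_central_carrier commutator_def)

text \<open>Meant for a quotient of \<open>G\<close>. There c is central and cancels against its own
  inverse; d is only known to commute with the image of one term of the series, which contains y and
  z y^-1 z^-1, and this is enough to move d past both until it meets d^-1.\<close>

lemma commutator_absorb:
  assumes "c \<in> carrier G" "d \<in> carrier G" "y \<in> carrier G" "z \<in> carrier G"
    and c: "\<And>w. w \<in> carrier G \<Longrightarrow> c \<otimes> w = w \<otimes> c"
    and d: "d \<otimes> y = y \<otimes> d" "d \<otimes> (z \<otimes> inv y \<otimes> inv z) = z \<otimes> inv y \<otimes> inv z \<otimes> d"
  shows "commutator G (c \<otimes> y) (d \<otimes> z) = commutator G y z"
proof -
  have "commutator G (c \<otimes> y) (d \<otimes> z) = c \<otimes> (y \<otimes> d \<otimes> z \<otimes> inv y) \<otimes> inv c \<otimes> inv z \<otimes> inv d"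
    using assms(1-4) by (simp add: commutator_def group_normalize)
  also have "\<dots> = (y \<otimes> d) \<otimes> z \<otimes> inv y \<otimes> inv z \<otimes> inv d"
    using assms(1-4) by (subst c) (simp_all add: group_normalize)
  also have "\<dots> = y \<otimes> (d \<otimes> (z \<otimes> inv y \<otimes> inv z)) \<otimes> inv d"
    using assms(1-4) by (simp add: group_normalize)
  also have "\<dots> = commutator G y z"
    unfolding d using assms(1-4) by (simp add: commutator_def group_normalize)
  finally show ?thesis .
qed

text \<open>Taking inner automorphisms for \<open>\<alpha>\<close>, the induction hypothesis includes the corresponding
  statement about commutators in \<open>G\<close>.\<close>

lemma johnson_filtration_lower_central:
  assumes "\<alpha> \<in> johnson_filtration G s" "x \<in> lower_central G t" "t \<ge> 1"
  shows "\<alpha> x \<otimes> inv x \<in> lower_central G (s + t)"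
  using assms(3,1,2)
proof (induction t arbitrary: s \<alpha> x rule: dec_induct)
  case base
  then show ?case using johnson_filtrationD(2) [of \<alpha> s x] by simp
next
  case (step t)
  \<comment> \<open>The claim says that \<alpha> fixes x modulo \<open>?N\<close>, so the
    commutators are compared in the quotient \<open>G Mod ?N\<close>.\<close>
  let ?N = "lower_central G (s + Suc t)"
  let ?S = "{commutator G x y | x y. x \<in> lower_central G t \<and> y \<in> carrier G}"
  let ?\<pi> = "\<lambda>x. ?N #> x"
  have \<alpha>: "\<alpha> \<in> carrier (AutoGroup G)"
    using step.prems johnson_filtrationD by blast
  interpret N: normal ?N G by (rule lower_central_normal)
  interpret Q: group "G Mod ?N" by (rule N.factorgroup_is_group)
  interpret \<pi>: group_hom G "G Mod ?N" ?\<pi>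
    by unfold_locales (rule N.r_coset_hom_Mod)
  interpret \<alpha>: group_hom G G \<alpha> by (rule AutoGroup_hom [OF \<alpha>])
  have commute: "?\<pi> x \<otimes>\<^bsub>G Mod ?N\<^esub> ?\<pi> y = ?\<pi> y \<otimes>\<^bsub>G Mod ?N\<^esub> ?\<pi> x"
    if x: "x \<in> carrier G" and y: "y \<in> carrier G" and "commutator G x y \<in> ?N" for x y
  proof -
    have "commutator (G Mod ?N) (?\<pi> x) (?\<pi> y) = \<one>\<^bsub>G Mod ?N\<^esub>"
      using that(3) N.rcos_const [OF is_group] \<pi>.hom_commutator [OF x y] by simp
    then show ?thesis
      using Q.commutator_eq_one_iff [OF \<pi>.hom_closed [OF x] \<pi>.hom_closed [OF y]] by blast
  qed
  have gen: "commutator G y z \<in> {w \<in> carrier G. ?\<pi> (\<alpha> w) = ?\<pi> w}"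
    if y: "y \<in> lower_central G t" and z: "z \<in> carrier G" for y z
  proof -
    define c where "c = \<alpha> y \<otimes> inv y"
    define d where "d = \<alpha> z \<otimes> inv z"
    have yG: "y \<in> carrier G" using y by (rule lower_central_carrier)
    have c: "c \<in> lower_central G (s + t)"
      unfolding c_def by (rule step.IH [OF step.prems(1) y])
    have d: "d \<in> lower_central G (Suc s)"
      unfolding d_def by (rule johnson_filtrationD(2) [OF step.prems(1) z])
    have cG: "c \<in> carrier G" and dG: "d \<in> carrier G"
      using c d by (auto intro: lower_central_carrier)
    \<comment> \<open>The induction hypothesis for conjugation by d, which lies in step
      \<open>Suc s\<close>: the result has degree \<open>Suc s + t\<close>, exactly that of
      \<open>?N\<close>. This is why s and \<alpha> are generalised in the induction.\<close>
    have d_comm: "commutator G d w \<in> ?N" if "w \<in> lower_central G t" for w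
      using step.IH [OF conjugation_johnson_filtration [OF d] that] that
      by (simp add: lower_central_carrier commutator_def)
    \<comment> \<open>Makes c central modulo \<open>?N\<close>. The index \<open>s + t - 1\<close>
      only brings the degree \<open>s + t\<close>, positive because t is at least 1, into successor
      form.\<close>
    have c_comm: "commutator G c w \<in> ?N" if "w \<in> carrier G" for w
      using commutator_lower_central_carrier [of c "s + t - 1" w] c that step.hyps by simp
    \<comment> \<open>By normality z y^-1 z^-1 has the same degree as y, so \<open>d_comm\<close>
      applies to it as well.\<close>
    have conj: "z \<otimes> inv y \<otimes> inv z \<in> lower_central G t"
      using y z normal_invE [OF lower_central_normal] lower_central_subgroup
      by (simp add: subgroup.m_inv_closed)
    have "?\<pi> (\<alpha> (commutator G y z)) = ?\<pi> (commutator G (c \<otimes> y) (d \<otimes> z))"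
      using yG z \<alpha> by (simp add: AutoGroup_commutator c_def d_def m_assoc)
    also have "\<dots> = commutator (G Mod ?N) (?\<pi> c \<otimes>\<^bsub>G Mod ?N\<^esub> ?\<pi> y) (?\<pi> d \<otimes>\<^bsub>G Mod ?N\<^esub> ?\<pi> z)"
      using yG z cG dG by (simp only: \<pi>.hom_commutator \<pi>.hom_mult m_closed)
    also have "\<dots> = commutator (G Mod ?N) (?\<pi> y) (?\<pi> z)"
    proof (rule Q.commutator_absorb)
      fix w assume "w \<in> carrier (G Mod ?N)"
      then obtain v where "v \<in> carrier G" "w = ?\<pi> v"
        by (auto simp: carrier_FactGroup)
      then show "?\<pi> c \<otimes>\<^bsub>G Mod ?N\<^esub> w = w \<otimes>\<^bsub>G Mod ?N\<^esub> ?\<pi> c"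
        using commute [OF cG _ c_comm] by blast
    next
      show "?\<pi> d \<otimes>\<^bsub>G Mod ?N\<^esub> ?\<pi> y = ?\<pi> y \<otimes>\<^bsub>G Mod ?N\<^esub> ?\<pi> d"
        by (rule commute [OF dG yG d_comm [OF y]])
      show "?\<pi> d \<otimes>\<^bsub>G Mod ?N\<^esub> (?\<pi> z \<otimes>\<^bsub>G Mod ?N\<^esub> inv\<^bsub>G Mod ?N\<^esub> ?\<pi> y \<otimes>\<^bsub>G Mod ?N\<^esub> inv\<^bsub>G Mod ?N\<^esub> ?\<pi> z) =
          ?\<pi> z \<otimes>\<^bsub>G Mod ?N\<^esub> inv\<^bsub>G Mod ?N\<^esub> ?\<pi> y \<otimes>\<^bsub>G Mod ?N\<^esub> inv\<^bsub>G Mod ?N\<^esub> ?\<pi> z \<otimes>\<^bsub>G Mod ?N\<^esub> ?\<pi> d"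
        using commute [OF dG _ d_comm [OF conj]] yG z dG
        by (simp only: \<pi>.hom_mult \<pi>.hom_inv m_closed inv_closed)
    qed (use yG z cG dG in \<open>simp_all only: \<pi>.hom_closed\<close>)
    also have "\<dots> = ?\<pi> (commutator G y z)"
      using yG z by (simp only: \<pi>.hom_commutator)
    finally show ?thesis using yG z by simp
  qed
  \<comment> \<open>The set is the equaliser of the two homomorphisms \<open>?\<pi>\<close> and
    \<open>?\<pi>\<close> after \<alpha>, hence a subgroup, and checking the generators of degree
    \<open>Suc t\<close> is enough.\<close>
  have "subgroup {w \<in> carrier G. ?\<pi> (\<alpha> w) = ?\<pi> w} G"
  proof (rule subgroupI)
    fix a b assume a: "a \<in> {w \<in> carrier G. ?\<pi> (\<alpha> w) = ?\<pi> w}"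
    then have "?\<pi> (inv (\<alpha> a)) = ?\<pi> (inv a)"
      by (simp only: mem_Collect_eq \<pi>.hom_inv \<alpha>.hom_closed)
    with a show "inv a \<in> {w \<in> carrier G. ?\<pi> (\<alpha> w) = ?\<pi> w}" by simp
    assume b: "b \<in> {w \<in> carrier G. ?\<pi> (\<alpha> w) = ?\<pi> w}"
    with a have "?\<pi> (\<alpha> a \<otimes> \<alpha> b) = ?\<pi> (a \<otimes> b)"
      by (simp only: mem_Collect_eq \<pi>.hom_mult \<alpha>.hom_closed)
    with a b show "a \<otimes> b \<in> {w \<in> carrier G. ?\<pi> (\<alpha> w) = ?\<pi> w}" by simp
  qed auto
  then have "generate G ?S \<subseteq> {w \<in> carrier G. ?\<pi> (\<alpha> w) = ?\<pi> w}"
    by (intro generate_subgroup_incl) (use gen in auto)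
  moreover have "x \<in> generate G ?S"
    using step.prems(2) step.hyps by (cases t) (simp_all add: commutator_subgroup_def)
  ultimately have "?\<pi> (\<alpha> x) = ?\<pi> x" and "x \<in> carrier G" by auto
  then show ?case
    using N.rcos_eq_iff [of "\<alpha> x" x] by (simp only: \<alpha>.hom_closed)
qed

text \<open>The estimate for conjugation by x, an automorphism in step i of the Johnson
  filtration.\<close>

lemma commutator_lower_central:
  assumes "x \<in> lower_central G i" "y \<in> lower_central G j" "i \<ge> 1" "j \<ge> 1"
  shows "commutator G x y \<in> lower_central G (i + j)"
  using johnson_filtration_lower_central [OF conjugation_johnson_filtration [of x "i - 1"], of y j] assms
  by (simp add: commutator_def lower_central_carrier)

end

section \<open>The graded Lie algebra of an N-series\<close>

text \<open>Stated for an arbitrary group so that \<open>lower_central G\<close> in \<open>G\<close>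
  and \<open>johnson_filtration G\<close> in \<open>AutoGroup G\<close> share one calculus of
  cosets. Indices start at 0 because the degree 0 piece of the Johnson filtration is
  \<open>A_group G\<close>.\<close>

locale normal_series = group G for G (structure) +
  fixes K :: "nat \<Rightarrow> 'a set"
  assumes normal_series: "K n \<lhd> G"
    and Suc_subset: "K (Suc n) \<subseteq> K n"
begin

lemma subgroup_series: "subgroup (K n) G"
  using normal_series normal_imp_subgroup by blast

lemmas series_carrier [simp] = subgroup.mem_carrier [OF subgroup_series]
lemmas series_mult_closed [simp] = subgroup.m_closed [OF subgroup_series]
lemmas series_inv_closed [simp] = subgroup.m_inv_closed [OF subgroup_series]
lemmas series_one_closed [simp] = subgroup.one_closed [OF subgroup_series]

lemma series_antimono: "m \<le> n \<Longrightarrow> K n \<subseteq> K m"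
  by (rule lift_Suc_antimono_le [where f = K]) (rule Suc_subset)

lemma coset_eq_iff:
  "\<lbrakk>x \<in> carrier G; y \<in> carrier G\<rbrakk> \<Longrightarrow> K n #> x = K n #> y \<longleftrightarrow> x \<otimes> inv y \<in> K n"
  by (rule normal.rcos_eq_iff [OF normal_series])

lemma coset_mult:
  "\<lbrakk>x \<in> carrier G; y \<in> carrier G\<rbrakk> \<Longrightarrow> K n #> (x \<otimes> y) = (K n #> x) <#> (K n #> y)"
  by (rule normal.rcos_sum [OF normal_series, symmetric])

lemma coset_member: "x \<in> K n \<Longrightarrow> K n #> x = K n"
  by (rule subgroup.rcos_const [OF subgroup_series is_group])

lemma gr_piece_carrier: "carrier (gr_piece G K n) = (\<lambda>x. K (Suc n) #> x) ` K n"
  by (simp add: gr_piece_def carrier_FactGroup r_coset_def)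

lemma gr_piece_one: "\<one>\<^bsub>gr_piece G K n\<^esub> = K (Suc n)"
  by (simp add: gr_piece_def)

lemma gr_piece_mult: "A \<otimes>\<^bsub>gr_piece G K n\<^esub> B = A <#> B"
  by (simp add: gr_piece_def set_mult_def)

lemma gr_piece_group: "group (gr_piece G K n)"
  unfolding gr_piece_def
  by (rule normal.factorgroup_is_group, rule normal_restrict_supergroup)
    (rule subgroup_series normal_series Suc_subset)+

lemma gr_piece_repr:
  assumes "A \<in> carrier (gr_piece G K n)" "x \<in> A"
  shows "x \<in> K n" "A = K (Suc n) #> x"
proof -
  obtain y where y: "y \<in> K n" "A = K (Suc n) #> y"
    using assms by (auto simp: gr_piece_carrier)
  then obtain k where "k \<in> K (Suc n)" "x = k \<otimes> y"
    using assms(2) by (auto simp: r_coset_def)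
  then show "x \<in> K n"
    using y Suc_subset by (auto intro!: series_mult_closed)
  show "A = K (Suc n) #> x"
    using assms(2) y repr_independence [OF _ _ subgroup_series] by simp
qed

lemma gr_piece_repr_ex:
  assumes "A \<in> carrier (gr_piece G K n)"
  obtains x where "x \<in> K n" "A = K (Suc n) #> x"
  using assms by (auto simp: gr_piece_carrier)

lemma coset_in_gr_piece: "x \<in> K n \<Longrightarrow> K (Suc n) #> x \<in> carrier (gr_piece G K n)"
  by (auto simp: gr_piece_carrier)

lemma coset_nonempty: "x \<in> K n \<Longrightarrow> x \<in> K (Suc n) #> x"
  by (simp add: rcos_self subgroup_series)

lemma gr_carrier:
  "carrier (gr G K) = {x \<in> \<Pi>\<^sub>E n\<in>{1..}. carrier (gr_piece G K n). finite {n \<in> {1..}. x n \<noteq> K (Suc n)}}"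
  by (simp add: gr_def gr_sum_def carrier_sum_group gr_piece_group gr_piece_one)

lemma gr_component_carrier: "\<lbrakk>x \<in> carrier (gr G K); n \<ge> 1\<rbrakk> \<Longrightarrow> x n \<in> carrier (gr_piece G K n)"
  by (auto simp: gr_carrier)

lemma gr_eqI:
  assumes "x \<in> carrier (gr G K)" "y \<in> carrier (gr G K)" "\<And>n. n \<ge> 1 \<Longrightarrow> x n = y n"
  shows "x = y"
  using assms by (intro extensionalityI [of x "{1..}" y]) (auto simp: gr_carrier PiE_def)

lemma gr_mult: "x \<otimes>\<^bsub>gr G K\<^esub> y = (\<lambda>n\<in>{1..}. x n \<otimes>\<^bsub>gr_piece G K n\<^esub> y n)"
  by (simp add: gr_def gr_sum_def)

lemma gr_one: "\<one>\<^bsub>gr G K\<^esub> = (\<lambda>n\<in>{1..}. K (Suc n))"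
  by (simp add: gr_def gr_sum_def gr_piece_one)

lemma gr_group: "group (gr G K)"
proof -
  interpret S: group "gr_sum G K"
    by (simp add: gr_sum_def gr_piece_group)
  show ?thesis
    by (rule groupI) (auto simp: gr_def S.m_assoc intro: S.l_inv_ex)
qed

lemma gr_component:
  "component (gr G K) n = {x \<in> carrier (gr G K). \<forall>i\<in>{1..}. i \<noteq> n \<longrightarrow> x i = K (Suc i)}"
  by (simp add: gr_def gr_piece_one)

lemma gr_bracket:
  "lie_bracket (gr G K) x y = (\<lambda>r\<in>{1..}.
     finprod (gr_piece G K r) (\<lambda>i. gr_piece_bracket G K i (r - i) (x i) (y (r - i))) {1..<r})"
  by (simp add: gr_def)

end

text \<open>The commutator condition is what makes the quotients a graded Lie ring: with i = j it
  gives abelian pieces, and in general it makes the commutator well defined and bilinear on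
  cosets.\<close>

locale N_series = normal_series +
  assumes commutator_series:
    "\<lbrakk>x \<in> K i; y \<in> K j; i \<ge> 1; j \<ge> 1\<rbrakk> \<Longrightarrow> commutator G x y \<in> K (i + j)"
begin

section \<open>Commutator calculus modulo deeper terms of the series\<close>

lemma commutator_series_le:
  "\<lbrakk>x \<in> K i; y \<in> K j; i \<ge> 1; j \<ge> 1; n \<le> i + j\<rbrakk> \<Longrightarrow> commutator G x y \<in> K n"
  using commutator_series series_antimono by blast

text \<open>Together with \<open>coset_conj\<close>, the rule behind the calculations modulo
  \<open>K n\<close>: factors of degrees i and j may be exchanged, and conjugations dropped, as soon
  as i + j reaches n.\<close>

lemma coset_commute:
  assumes "x \<in> K i" "y \<in> K j" "i \<ge> 1" "j \<ge> 1" "n \<le> i + j"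
  shows "K n #> (x \<otimes> y) = K n #> (y \<otimes> x)"
proof -
  have "x \<otimes> y \<otimes> inv (y \<otimes> x) = commutator G x y"
    using assms by (simp add: commutator_def group_normalize)
  then show ?thesis
    using assms commutator_series_le by (simp add: coset_eq_iff)
qed

lemma coset_conj:
  assumes "x \<in> K i" "y \<in> K j" "i \<ge> 1" "j \<ge> 1" "n \<le> i + j"
  shows "K n #> (x \<otimes> y \<otimes> inv x) = K n #> y"
proof -
  have "x \<otimes> y \<otimes> inv x \<otimes> inv y = commutator G x y"
    using assms by (simp add: commutator_def)
  then show ?thesis
    using assms commutator_series_le by (simp add: coset_eq_iff)
qed

lemma gr_piece_comm_group:
  assumes "n \<ge> 1"
  shows "comm_group (gr_piece G K n)"
proof -
  interpret P: group "gr_piece G K n" by (rule gr_piece_group)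
  show ?thesis
  proof (rule P.group_comm_groupI)
    fix A B assume "A \<in> carrier (gr_piece G K n)" "B \<in> carrier (gr_piece G K n)"
    then obtain x y where "x \<in> K n" "A = K (Suc n) #> x" "y \<in> K n" "B = K (Suc n) #> y"
      by (metis gr_piece_repr_ex)
    then show "A \<otimes>\<^bsub>gr_piece G K n\<^esub> B = B \<otimes>\<^bsub>gr_piece G K n\<^esub> A"
      using coset_commute [of x n y n "Suc n"] assms by (simp add: gr_piece_mult flip: coset_mult)
  qed
qed

lemma commutator_mult_left:
  assumes "x \<in> carrier G" "x' \<in> carrier G" "y \<in> carrier G"
  shows "commutator G (x \<otimes> x') y = x \<otimes> commutator G x' y \<otimes> inv x \<otimes> commutator G x y"
  using assms by (simp add: commutator_def group_normalize)

lemma commutator_mult_right: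
  assumes "x \<in> carrier G" "y \<in> carrier G" "y' \<in> carrier G"
  shows "commutator G x (y \<otimes> y') = commutator G x y \<otimes> (y \<otimes> commutator G x y' \<otimes> inv y)"
  using assms by (simp add: commutator_def group_normalize)

text \<open>The exact product rule contains a conjugation by x. It acts on an element of degree i +
  j and has degree at least 1 itself, so it disappears modulo degree i + j + 1; the two factors are
  then exchanged for the same kind of reason.\<close>

lemma coset_commutator_mult_left:
  assumes "x \<in> K i" "x' \<in> K i" "y \<in> K j" "i \<ge> 1" "j \<ge> 1"
  shows "K (Suc (i + j)) #> commutator G (x \<otimes> x') y =
    K (Suc (i + j)) #> (commutator G x y \<otimes> commutator G x' y)"
proof -
  have "K (Suc (i + j)) #> commutator G (x \<otimes> x') y =
      K (Suc (i + j)) #> (commutator G x' y \<otimes> commutator G x y)"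
    using assms coset_conj [of x i "commutator G x' y" "i + j"] commutator_series
    by (simp add: commutator_mult_left coset_mult [of "_ \<otimes> inv _"] flip: coset_mult)
  also have "\<dots> = K (Suc (i + j)) #> (commutator G x y \<otimes> commutator G x' y)"
    by (rule coset_commute [of _ "i + j" _ "i + j"]) (use assms commutator_series in auto)
  finally show ?thesis .
qed

lemma coset_commutator_mult_right:
  assumes "x \<in> K i" "y \<in> K j" "y' \<in> K j" "i \<ge> 1" "j \<ge> 1"
  shows "K (Suc (i + j)) #> commutator G x (y \<otimes> y') =
    K (Suc (i + j)) #> (commutator G x y \<otimes> commutator G x y')"
  using assms coset_conj [of y j "commutator G x y'" "i + j"] commutator_series
  by (simp add: commutator_mult_right coset_mult [of _ "_ \<otimes> inv _"] flip: coset_mult)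

text \<open>Origin of the Leibniz rule. Both product rules expand the commutator; every conjugation
  raises the degree beyond s + i + j, and the mixed term (c, d) has degree 2s + i + j, which is too
  deep exactly because s is at least 1.\<close>

lemma coset_commutator_perturb:
  assumes "c \<in> K (s + i)" "x \<in> K i" "d \<in> K (s + j)" "y \<in> K j" "s \<ge> 1" "i \<ge> 1" "j \<ge> 1"
  shows "K (Suc (s + i + j)) #> commutator G (c \<otimes> x) (d \<otimes> y) =
    K (Suc (s + i + j)) #> (commutator G c y \<otimes> commutator G x d \<otimes> commutator G x y)"
proof -
  let ?N = "K (Suc (s + i + j))"
  have [simp]: "c \<in> carrier G" "x \<in> carrier G" "d \<in> carrier G" "y \<in> carrier G"
    using assms by auto
  \<comment> \<open>Allows d y to count as an element of degree j, so that (x, d y) has degree i +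
    j.\<close>
  have d': "d \<in> K j"
    using assms series_antimono by (metis add_leE le_refl subsetD le_add2)
  have comms: "commutator G c y \<in> K (s + i + j)" "commutator G x d \<in> K (s + i + j)"
    "commutator G x y \<in> K (i + j)" "commutator G c d \<in> ?N"
    "commutator G x (d \<otimes> y) \<in> K (i + j)"
    using assms d' by (auto intro: commutator_series_le series_mult_closed)
  have "?N #> commutator G (c \<otimes> x) (d \<otimes> y) =
      (?N #> (c \<otimes> commutator G x (d \<otimes> y) \<otimes> inv c)) <#> (?N #> commutator G c (d \<otimes> y))"
    by (simp add: commutator_mult_left flip: coset_mult)
  also have "?N #> (c \<otimes> commutator G x (d \<otimes> y) \<otimes> inv c) = ?N #> commutator G x (d \<otimes> y)"
    by (rule coset_conj [of _ "s + i" _ "i + j"]) (use assms comms in auto)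
  also have "\<dots> = (?N #> commutator G x d) <#> (?N #> (d \<otimes> commutator G x y \<otimes> inv d))"
    by (simp add: commutator_mult_right flip: coset_mult)
  also have "?N #> (d \<otimes> commutator G x y \<otimes> inv d) = ?N #> commutator G x y"
    by (rule coset_conj [of _ "s + j" _ "i + j"]) (use assms comms in auto)
  also have "?N #> commutator G c (d \<otimes> y) =
      (?N #> commutator G c d) <#> (?N #> (d \<otimes> commutator G c y \<otimes> inv d))"
    by (simp add: commutator_mult_right flip: coset_mult)
  also have "?N #> (d \<otimes> commutator G c y \<otimes> inv d) = ?N #> commutator G c y"
    by (rule coset_conj [of _ "s + j" _ "s + i + j"]) (use assms comms in auto)
  also have "?N #> commutator G c d = ?N #> \<one>"
    using comms(4) by (simp add: coset_member)
  also have "(?N #> \<one>) <#> (?N #> commutator G c y) = ?N #> commutator G c y"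
    by (simp flip: coset_mult)
  also have "(?N #> commutator G x d) <#> (?N #> commutator G x y) <#> (?N #> commutator G c y) =
      ?N #> (commutator G x d \<otimes> commutator G x y \<otimes> commutator G c y)"
    by (simp flip: coset_mult)
  \<comment> \<open>A factor in \<open>K (s + i + j)\<close> commutes modulo \<open>?N\<close> with
    all of \<open>K 1\<close>; the degrees 1 and s + i + j add up to the index of \<open>?N\<close>
    exactly.\<close>
  also have "\<dots> = ?N #> (commutator G c y \<otimes> (commutator G x d \<otimes> commutator G x y))"
    by (rule coset_commute [of _ 1 _ "s + i + j"])
      (use assms comms in \<open>auto intro!: series_mult_closed intro: series_antimono [THEN subsetD, rotated]\<close>)
  finally show ?thesis by (simp add: m_assoc)
qed

text \<open>Other representatives are a x and b y with a and b one degree deeper. By bilinearity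
  modulo degree i + j + 1 they contribute (a, y') and (x, b), and both of these lie in that
  degree.\<close>

lemma gr_piece_bracket_coset:
  assumes x: "x \<in> K i" and y: "y \<in> K j" and "i \<ge> 1" "j \<ge> 1"
  shows "gr_piece_bracket G K i j (K (Suc i) #> x) (K (Suc j) #> y) =
    K (Suc (i + j)) #> commutator G x y"
proof -
  have "K (Suc (i + j)) #> commutator G x' y' = K (Suc (i + j)) #> commutator G x y"
    if x': "x' \<in> K (Suc i) #> x" and y': "y' \<in> K (Suc j) #> y" for x' y'
  proof -
    obtain a where a: "a \<in> K (Suc i)" "x' = a \<otimes> x"
      using x' by (auto simp: r_coset_def)
    obtain b where b: "b \<in> K (Suc j)" "y' = b \<otimes> y"
      using y' by (auto simp: r_coset_def)
    have ab: "a \<in> K i" "b \<in> K j" using a b Suc_subset by auto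
    have 1: "commutator G a y' \<in> K (Suc (i + j))"
      using a b ab assms by (intro commutator_series_le [of _ "Suc i" _ j]) auto
    have 2: "commutator G x b \<in> K (Suc (i + j))"
      using a b ab assms by (intro commutator_series_le [of _ i _ "Suc j"]) auto
    have "K (Suc (i + j)) #> commutator G x' y' = K (Suc (i + j)) #> (commutator G a y' \<otimes> commutator G x y')"
      using a b ab assms by (simp add: coset_commutator_mult_left)
    also have "\<dots> = K (Suc (i + j)) #> commutator G x y'"
      using 1 ab b assms by (simp add: coset_eq_iff m_assoc)
    also have "\<dots> = K (Suc (i + j)) #> (commutator G x b \<otimes> commutator G x y)"
      using a b ab assms by (simp add: coset_commutator_mult_right)
    also have "\<dots> = K (Suc (i + j)) #> commutator G x y"
      using 2 ab b assms by (simp add: coset_eq_iff m_assoc)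
    finally show ?thesis .
  qed
  then show ?thesis
    unfolding gr_piece_bracket_def
    by (rule the_elem_image_pair [OF coset_nonempty [OF x] coset_nonempty [OF y]])
qed

lemma gr_piece_bracket_closed:
  assumes "A \<in> carrier (gr_piece G K i)" "B \<in> carrier (gr_piece G K j)" "i \<ge> 1" "j \<ge> 1"
  shows "gr_piece_bracket G K i j A B \<in> carrier (gr_piece G K (i + j))"
proof -
  obtain x y where "x \<in> K i" "A = K (Suc i) #> x" "y \<in> K j" "B = K (Suc j) #> y"
    using assms by (metis gr_piece_repr_ex)
  then show ?thesis
    using assms commutator_series by (simp add: gr_piece_bracket_coset coset_in_gr_piece)
qed

lemma gr_piece_bracket_mult_left:
  assumes "A \<in> carrier (gr_piece G K i)" "A' \<in> carrier (gr_piece G K i)"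
    and "B \<in> carrier (gr_piece G K j)" "i \<ge> 1" "j \<ge> 1"
  shows "gr_piece_bracket G K i j (A \<otimes>\<^bsub>gr_piece G K i\<^esub> A') B =
    gr_piece_bracket G K i j A B \<otimes>\<^bsub>gr_piece G K (i + j)\<^esub> gr_piece_bracket G K i j A' B"
proof -
  obtain x x' y where "x \<in> K i" "A = K (Suc i) #> x" "x' \<in> K i" "A' = K (Suc i) #> x'"
      "y \<in> K j" "B = K (Suc j) #> y"
    using assms by (metis gr_piece_repr_ex)
  then show ?thesis
    using assms coset_commutator_mult_left [of x i x' y j]
    by (simp add: gr_piece_bracket_coset gr_piece_mult flip: coset_mult)
qed

lemma gr_piece_bracket_mult_right:
  assumes "A \<in> carrier (gr_piece G K i)" "B \<in> carrier (gr_piece G K j)"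
    and "B' \<in> carrier (gr_piece G K j)" "i \<ge> 1" "j \<ge> 1"
  shows "gr_piece_bracket G K i j A (B \<otimes>\<^bsub>gr_piece G K j\<^esub> B') =
    gr_piece_bracket G K i j A B \<otimes>\<^bsub>gr_piece G K (i + j)\<^esub> gr_piece_bracket G K i j A B'"
proof -
  obtain x y y' where "x \<in> K i" "A = K (Suc i) #> x" "y \<in> K j" "B = K (Suc j) #> y"
      "y' \<in> K j" "B' = K (Suc j) #> y'"
    using assms by (metis gr_piece_repr_ex)
  then show ?thesis
    using assms coset_commutator_mult_right [of x i y j y']
    by (simp add: gr_piece_bracket_coset gr_piece_mult flip: coset_mult)
qed

lemma gr_piece_bracket_one:
  assumes "A \<in> carrier (gr_piece G K i)" "B \<in> carrier (gr_piece G K j)" "i \<ge> 1" "j \<ge> 1"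
  shows "gr_piece_bracket G K i j A (K (Suc j)) = K (Suc (i + j))"
    and "gr_piece_bracket G K i j (K (Suc i)) B = K (Suc (i + j))"
proof -
  obtain x y where "x \<in> K i" "A = K (Suc i) #> x" "y \<in> K j" "B = K (Suc j) #> y"
    using assms by (metis gr_piece_repr_ex)
  moreover from this have "commutator G x \<one> = \<one>" "commutator G \<one> y = \<one>"
    by (simp_all add: commutator_eq_one_iff)
  ultimately show "gr_piece_bracket G K i j A (K (Suc j)) = K (Suc (i + j))"
    and "gr_piece_bracket G K i j (K (Suc i)) B = K (Suc (i + j))"
    using assms gr_piece_bracket_coset [of x i \<one> j] gr_piece_bracket_coset [of \<one> i y j]
    by (simp_all add: coset_member)
qed

end

text \<open>Between monoids \<open>hom\<close> does not include preservation of the unit, hence the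
  separate assumption. It settles the empty index set, and also the infinite one, where
  \<open>finprod\<close> takes the unit as its default value.\<close>

lemma hom_finprod:
  assumes "comm_monoid G" "comm_monoid H" "h \<in> hom G H" "h \<one>\<^bsub>G\<^esub> = \<one>\<^bsub>H\<^esub>" "f \<in> A \<rightarrow> carrier G"
  shows "h (finprod G f A) = finprod H (\<lambda>i. h (f i)) A"
proof -
  interpret G: comm_monoid G by fact
  interpret H: comm_monoid H by fact
  show ?thesis
    using assms(5)
  proof (induction A rule: infinite_finite_induct)
    case (insert a A)
    then have "(\<lambda>i. h (f i)) \<in> A \<rightarrow> carrier H" "h (f a) \<in> carrier H"
      using assms(3) by (auto simp: Pi_iff hom_in_carrier)
    then show ?case
      using insert hom_mult [OF assms(3)] by (simp add: Pi_iff)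
  qed (simp_all add: assms(4))
qed

context N_series
begin

section \<open>The direct sum of the pieces with its bracket\<close>

lemma gr_comm_group: "comm_group (gr G K)"
proof -
  interpret L: group "gr G K" by (rule gr_group)
  show ?thesis
  proof (rule L.group_comm_groupI)
    fix x y assume "x \<in> carrier (gr G K)" "y \<in> carrier (gr G K)"
    then have "x n \<otimes>\<^bsub>gr_piece G K n\<^esub> y n = y n \<otimes>\<^bsub>gr_piece G K n\<^esub> x n" if "n \<ge> 1" for n
      using comm_group.axioms(1) [OF gr_piece_comm_group [OF that]] that
      by (intro comm_monoid.m_comm gr_component_carrier)
    then show "x \<otimes>\<^bsub>gr G K\<^esub> y = y \<otimes>\<^bsub>gr G K\<^esub> x"
      by (auto simp: gr_mult intro!: restrict_ext)
  qed
qed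

text \<open>Finite support as a bound on the degrees, the form that suits convolutions and degree
  shifts: bounds M and N give M + N for a bracket, and N becomes s + N under a map of degree
  s.\<close>

lemma gr_eventually_one:
  assumes "x \<in> carrier (gr G K)"
  shows "\<exists>N. \<forall>n>N. x n = K (Suc n)"
proof -
  have "finite {n \<in> {1..}. x n \<noteq> K (Suc n)}"
    using assms by (simp add: gr_carrier)
  then obtain N where N: "\<forall>n \<in> {n \<in> {1..}. x n \<noteq> K (Suc n)}. n \<le> N"
    unfolding finite_nat_set_iff_bounded_le ..
  have "x n = K (Suc n)" if "n > N" for n
  proof (rule ccontr)
    assume "x n \<noteq> K (Suc n)"
    with that have "n \<in> {n \<in> {1..}. x n \<noteq> K (Suc n)}" by simp
    with N have "n \<le> N" by blast
    with that show False by simp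
  qed
  then show ?thesis by blast
qed

lemma gr_carrierI:
  assumes "x \<in> extensional {1..}" "\<And>n. n \<ge> 1 \<Longrightarrow> x n \<in> carrier (gr_piece G K n)"
    and "\<And>n. n > N \<Longrightarrow> x n = K (Suc n)"
  shows "x \<in> carrier (gr G K)"
proof -
  have "{n \<in> {1..}. x n \<noteq> K (Suc n)} \<subseteq> {..N}"
    using assms(3) by (force simp: not_less)
  then have "finite {n \<in> {1..}. x n \<noteq> K (Suc n)}"
    using finite_subset by blast
  with assms(1,2) show ?thesis
    by (auto simp: gr_carrier PiE_iff)
qed

lemma gr_bracket_term_closed:
  assumes "x \<in> carrier (gr G K)" "y \<in> carrier (gr G K)" "i \<in> {1..<r}"
  shows "gr_piece_bracket G K i (r - i) (x i) (y (r - i)) \<in> carrier (gr_piece G K r)"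
  using gr_piece_bracket_closed [OF gr_component_carrier gr_component_carrier, of x i y "r - i"] assms
  by auto

lemma gr_bracket_closed:
  assumes x: "x \<in> carrier (gr G K)" and y: "y \<in> carrier (gr G K)"
  shows "lie_bracket (gr G K) x y \<in> carrier (gr G K)"
proof -
  obtain M where M: "\<forall>n>M. x n = K (Suc n)" using gr_eventually_one [OF x] by blast
  obtain N where N: "\<forall>n>N. y n = K (Suc n)" using gr_eventually_one [OF y] by blast
  show ?thesis
  proof (rule gr_carrierI [where N = "M + N"])
    fix r :: nat assume r: "r \<ge> 1"
    interpret P: comm_group "gr_piece G K r" by (rule gr_piece_comm_group [OF r])
    show "lie_bracket (gr G K) x y r \<in> carrier (gr_piece G K r)"
      using r gr_bracket_term_closed [OF x y] by (auto simp: gr_bracket)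
  next
    fix r :: nat assume r: "r > M + N"
    then have "r \<ge> 1" by simp
    interpret P: comm_group "gr_piece G K r" by (rule gr_piece_comm_group [OF \<open>r \<ge> 1\<close>])
    have "gr_piece_bracket G K i (r - i) (x i) (y (r - i)) = \<one>\<^bsub>gr_piece G K r\<^esub>" if "i \<in> {1..<r}" for i
    \<comment> \<open>Since i and r - i add up to r, which exceeds M + N, at least one of the two
      factors lies beyond its bound and is zero.\<close>
    proof (cases "i > M")
      case True
      then show ?thesis
        using gr_piece_bracket_one(2) [OF gr_component_carrier [OF x] gr_component_carrier [OF y],
            of i "r - i"] M that Suc_leI [of 0 "r - i"] by (simp add: gr_piece_one)
    next
      case False
      then have "r - i > N" using r by simp
      then show ?thesis
        using gr_piece_bracket_one(1) [OF gr_component_carrier [OF x] gr_component_carrier [OF y],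
            of i "r - i"] N that Suc_leI [of 0 "r - i"] by (simp add: gr_piece_one)
    qed
    then have "finprod (gr_piece G K r) (\<lambda>i. gr_piece_bracket G K i (r - i) (x i) (y (r - i))) {1..<r} =
        \<one>\<^bsub>gr_piece G K r\<^esub>"
      by (rule P.finprod_one_eqI)
    then show "lie_bracket (gr G K) x y r = K (Suc r)"
      using \<open>r \<ge> 1\<close> by (simp add: gr_bracket gr_piece_one)
  qed (simp add: gr_bracket)
qed

lemma gr_bracket_mult_left:
  assumes x: "x \<in> carrier (gr G K)" and x': "x' \<in> carrier (gr G K)" and y: "y \<in> carrier (gr G K)"
  shows "lie_bracket (gr G K) (x \<otimes>\<^bsub>gr G K\<^esub> x') y =
    lie_bracket (gr G K) x y \<otimes>\<^bsub>gr G K\<^esub> lie_bracket (gr G K) x' y"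
proof -
  have "finprod (gr_piece G K r)
      (\<lambda>i. gr_piece_bracket G K i (r - i) ((x \<otimes>\<^bsub>gr G K\<^esub> x') i) (y (r - i))) {1..<r} =
    finprod (gr_piece G K r) (\<lambda>i. gr_piece_bracket G K i (r - i) (x i) (y (r - i))) {1..<r}
      \<otimes>\<^bsub>gr_piece G K r\<^esub>
    finprod (gr_piece G K r) (\<lambda>i. gr_piece_bracket G K i (r - i) (x' i) (y (r - i))) {1..<r}"
    if r: "r \<ge> 1" for r
  proof -
    interpret P: comm_group "gr_piece G K r" by (rule gr_piece_comm_group [OF r])
    have *: "gr_piece_bracket G K i (r - i) ((x \<otimes>\<^bsub>gr G K\<^esub> x') i) (y (r - i)) =
        gr_piece_bracket G K i (r - i) (x i) (y (r - i)) \<otimes>\<^bsub>gr_piece G K r\<^esub>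
        gr_piece_bracket G K i (r - i) (x' i) (y (r - i))" if "i \<in> {1..<r}" for i
      using gr_piece_bracket_mult_left [of "x i" i "x' i" "y (r - i)" "r - i"] that Suc_leI [of 0 "r - i"]
        gr_component_carrier [OF x] gr_component_carrier [OF x'] gr_component_carrier [OF y]
      by (simp add: gr_mult)
    note closed = gr_bracket_term_closed [OF x y] gr_bracket_term_closed [OF x' y]
    let ?b = "\<lambda>x y i. gr_piece_bracket G K i (r - i) (x i) (y (r - i))"
    have "finprod (gr_piece G K r) (?b (x \<otimes>\<^bsub>gr G K\<^esub> x') y) {1..<r} =
        finprod (gr_piece G K r) (\<lambda>i. ?b x y i \<otimes>\<^bsub>gr_piece G K r\<^esub> ?b x' y i) {1..<r}"
      by (rule P.finprod_cong') (use * closed in auto)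
    also have "\<dots> = finprod (gr_piece G K r) (?b x y) {1..<r} \<otimes>\<^bsub>gr_piece G K r\<^esub>
        finprod (gr_piece G K r) (?b x' y) {1..<r}"
      by (rule P.finprod_multf) (use closed in auto)
    finally show ?thesis .
  qed
  then show ?thesis
    by (auto simp: gr_bracket gr_mult intro!: restrict_ext)
qed

lemma gr_bracket_mult_right:
  assumes x: "x \<in> carrier (gr G K)" and y: "y \<in> carrier (gr G K)" and y': "y' \<in> carrier (gr G K)"
  shows "lie_bracket (gr G K) x (y \<otimes>\<^bsub>gr G K\<^esub> y') =
    lie_bracket (gr G K) x y \<otimes>\<^bsub>gr G K\<^esub> lie_bracket (gr G K) x y'"
proof -
  have "finprod (gr_piece G K r)
      (\<lambda>i. gr_piece_bracket G K i (r - i) (x i) ((y \<otimes>\<^bsub>gr G K\<^esub> y') (r - i))) {1..<r} =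
    finprod (gr_piece G K r) (\<lambda>i. gr_piece_bracket G K i (r - i) (x i) (y (r - i))) {1..<r}
      \<otimes>\<^bsub>gr_piece G K r\<^esub>
    finprod (gr_piece G K r) (\<lambda>i. gr_piece_bracket G K i (r - i) (x i) (y' (r - i))) {1..<r}"
    if r: "r \<ge> 1" for r
  proof -
    interpret P: comm_group "gr_piece G K r" by (rule gr_piece_comm_group [OF r])
    have *: "gr_piece_bracket G K i (r - i) (x i) ((y \<otimes>\<^bsub>gr G K\<^esub> y') (r - i)) =
        gr_piece_bracket G K i (r - i) (x i) (y (r - i)) \<otimes>\<^bsub>gr_piece G K r\<^esub>
        gr_piece_bracket G K i (r - i) (x i) (y' (r - i))" if "i \<in> {1..<r}" for i
      using gr_piece_bracket_mult_right [of "x i" i "y (r - i)" "r - i" "y' (r - i)"] that Suc_leI [of 0 "r - i"]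
        gr_component_carrier [OF x] gr_component_carrier [OF y] gr_component_carrier [OF y']
      by (simp add: gr_mult)
    note closed = gr_bracket_term_closed [OF x y] gr_bracket_term_closed [OF x y']
    let ?b = "\<lambda>x y i. gr_piece_bracket G K i (r - i) (x i) (y (r - i))"
    have "finprod (gr_piece G K r) (?b x (y \<otimes>\<^bsub>gr G K\<^esub> y')) {1..<r} =
        finprod (gr_piece G K r) (\<lambda>i. ?b x y i \<otimes>\<^bsub>gr_piece G K r\<^esub> ?b x y' i) {1..<r}"
      by (rule P.finprod_cong') (use * closed in auto)
    also have "\<dots> = finprod (gr_piece G K r) (?b x y) {1..<r} \<otimes>\<^bsub>gr_piece G K r\<^esub>
        finprod (gr_piece G K r) (?b x y') {1..<r}"
      by (rule P.finprod_multf) (use closed in auto)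
    finally show ?thesis .
  qed
  then show ?thesis
    by (auto simp: gr_bracket gr_mult intro!: restrict_ext)
qed

lemma gr_component_subgroup: "subgroup (component (gr G K) n) (gr G K)"
proof -
  interpret L: group "gr G K" by (rule gr_group)
  have one: "K (Suc i) \<otimes>\<^bsub>gr_piece G K i\<^esub> K (Suc i) = K (Suc i)" for i
    using group.is_monoid [OF gr_piece_group, of i] monoid.l_one monoid.one_closed
    by (metis gr_piece_one)
  show ?thesis
  proof (rule L.subgroupI)
    have "\<one>\<^bsub>gr G K\<^esub> \<in> component (gr G K) n"
      using L.one_closed by (auto simp: gr_component gr_one)
    then show "component (gr G K) n \<noteq> {}" by blast
  next
    fix x assume x: "x \<in> component (gr G K) n"
    then have xL: "x \<in> carrier (gr G K)" by (simp add: gr_component)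
    have "(inv\<^bsub>gr G K\<^esub> x) i = K (Suc i)" if i: "i \<in> {1..}" "i \<noteq> n" for i
    proof -
      interpret P: group "gr_piece G K i" by (rule gr_piece_group)
      have "(inv\<^bsub>gr G K\<^esub> x \<otimes>\<^bsub>gr G K\<^esub> x) i = \<one>\<^bsub>gr G K\<^esub> i"
        using xL by simp
      then have "(inv\<^bsub>gr G K\<^esub> x) i \<otimes>\<^bsub>gr_piece G K i\<^esub> \<one>\<^bsub>gr_piece G K i\<^esub> = \<one>\<^bsub>gr_piece G K i\<^esub>"
        using x i by (simp add: gr_mult gr_one gr_component gr_piece_one)
      then show ?thesis
        using gr_component_carrier [OF L.inv_closed [OF xL], of i] i
        by (metis P.r_one atLeast_iff gr_piece_one)
    qed
    then show "inv\<^bsub>gr G K\<^esub> x \<in> component (gr G K) n"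
      using L.inv_closed [OF xL] by (simp add: gr_component)
  next
    fix x y assume "x \<in> component (gr G K) n" "y \<in> component (gr G K) n"
    then show "x \<otimes>\<^bsub>gr G K\<^esub> y \<in> component (gr G K) n"
      using L.m_closed [of x y] one by (simp add: gr_component) (simp add: gr_mult)
  qed (auto simp: gr_component)
qed

end

section \<open>Derivations of a graded abelian group with a bilinear bracket\<close>

locale graded_bilinear = comm_group L for L :: "('a, 'b) graded_lie_scheme" (structure) +
  assumes bracket_closed:
      "\<lbrakk>x \<in> carrier L; y \<in> carrier L\<rbrakk> \<Longrightarrow> lie_bracket L x y \<in> carrier L"
    and bracket_mult_left:
      "\<lbrakk>x \<in> carrier L; x' \<in> carrier L; y \<in> carrier L\<rbrakk>
        \<Longrightarrow> lie_bracket L (x \<otimes> x') y = lie_bracket L x y \<otimes> lie_bracket L x' y"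
    and bracket_mult_right:
      "\<lbrakk>x \<in> carrier L; y \<in> carrier L; y' \<in> carrier L\<rbrakk>
        \<Longrightarrow> lie_bracket L x (y \<otimes> y') = lie_bracket L x y \<otimes> lie_bracket L x y'"
    and component_subgroup: "subgroup (component L n) L"
begin

lemma bracket_one:
  assumes "x \<in> carrier L"
  shows "lie_bracket L \<one> x = \<one>" "lie_bracket L x \<one> = \<one>"
  using bracket_mult_left [of \<one> \<one> x] bracket_mult_right [of x \<one> \<one>] assms
    r_cancel_one [of "lie_bracket L \<one> x" "lie_bracket L \<one> x"]
    r_cancel_one [of "lie_bracket L x \<one>" "lie_bracket L x \<one>"]
  by (simp_all add: bracket_closed)

lemma bracket_inv:
  assumes "x \<in> carrier L" "y \<in> carrier L"
  shows "lie_bracket L (inv x) y = inv (lie_bracket L x y)"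
    and "lie_bracket L x (inv y) = inv (lie_bracket L x y)"
proof -
  have "lie_bracket L (inv x) y \<otimes> lie_bracket L x y = \<one>"
    using assms bracket_mult_left [of "inv x" x y] by (simp add: bracket_one)
  then show "lie_bracket L (inv x) y = inv (lie_bracket L x y)"
    using assms by (intro inv_equality [symmetric]) (simp_all add: bracket_closed)
  have "lie_bracket L x (inv y) \<otimes> lie_bracket L x y = \<one>"
    using assms bracket_mult_right [of x "inv y" y] by (simp add: bracket_one)
  then show "lie_bracket L x (inv y) = inv (lie_bracket L x y)"
    using assms by (intro inv_equality [symmetric]) (simp_all add: bracket_closed)
qed

lemma der_carrierD:
  assumes "\<delta> \<in> der_carrier L s"
  shows "x \<in> carrier L \<Longrightarrow> \<delta> x \<in> carrier L"
    and "\<lbrakk>x \<in> carrier L; y \<in> carrier L\<rbrakk> \<Longrightarrow> \<delta> (x \<otimes> y) = \<delta> x \<otimes> \<delta> y"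
    and "\<lbrakk>x \<in> component L t; t \<ge> 1\<rbrakk> \<Longrightarrow> \<delta> x \<in> component L (t + s)"
    and "\<lbrakk>x \<in> carrier L; y \<in> carrier L\<rbrakk>
      \<Longrightarrow> \<delta> (lie_bracket L x y) = lie_bracket L (\<delta> x) y \<otimes> lie_bracket L x (\<delta> y)"
    and "\<delta> \<in> extensional (carrier L)"
  using assms by (auto simp: der_carrier_def hom_mult hom_in_carrier)

lemma der_carrierI:
  assumes "\<delta> \<in> extensional (carrier L)"
    and "\<And>x. x \<in> carrier L \<Longrightarrow> \<delta> x \<in> carrier L"
    and "\<And>x y. \<lbrakk>x \<in> carrier L; y \<in> carrier L\<rbrakk> \<Longrightarrow> \<delta> (x \<otimes> y) = \<delta> x \<otimes> \<delta> y"
    and "\<And>x t. \<lbrakk>x \<in> component L t; t \<ge> 1\<rbrakk> \<Longrightarrow> \<delta> x \<in> component L (t + s)"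
    and "\<And>x y. \<lbrakk>x \<in> carrier L; y \<in> carrier L\<rbrakk>
      \<Longrightarrow> \<delta> (lie_bracket L x y) = lie_bracket L (\<delta> x) y \<otimes> lie_bracket L x (\<delta> y)"
  shows "\<delta> \<in> der_carrier L s"
  using assms by (simp add: der_carrier_def hom_def)

text \<open>Needed for \<open>Der L\<close>: \<open>carrier_sum_group\<close> describes its carrier
  once every summand is a group. Commutativity keeps pointwise products additive, bilinearity keeps
  the Leibniz rule, and the components being subgroups keeps the degree.\<close>

lemma der_piece_group: "group (der_piece L s)"
proof (rule groupI)
  note sub [simp] = subgroup.mem_carrier [OF component_subgroup]
  fix \<delta> \<epsilon>
  assume \<delta>: "\<delta> \<in> carrier (der_piece L s)" and \<epsilon>: "\<epsilon> \<in> carrier (der_piece L s)"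
  note \<delta> = der_carrierD [OF \<delta> [unfolded der_piece_def, simplified]]
  note \<epsilon> = der_carrierD [OF \<epsilon> [unfolded der_piece_def, simplified]]
  have "(\<lambda>x\<in>carrier L. \<delta> x \<otimes> \<epsilon> x) \<in> der_carrier L s"
    by (rule der_carrierI)
      (auto simp: \<delta>(1,2,4) \<epsilon>(1,2,4) bracket_closed bracket_mult_left bracket_mult_right m_ac
        intro!: subgroup.m_closed [OF component_subgroup] \<delta>(3) \<epsilon>(3))
  then show "\<delta> \<otimes>\<^bsub>der_piece L s\<^esub> \<epsilon> \<in> carrier (der_piece L s)"
    by (simp add: der_piece_def)
next
  note sub [simp] = subgroup.mem_carrier [OF component_subgroup]
  have "(\<lambda>x\<in>carrier L. \<one>) \<in> der_carrier L s"
    by (rule der_carrierI) (auto simp: bracket_closed bracket_one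
      intro!: subgroup.one_closed [OF component_subgroup])
  then show "\<one>\<^bsub>der_piece L s\<^esub> \<in> carrier (der_piece L s)"
    by (simp add: der_piece_def)
next
  fix \<delta> assume "\<delta> \<in> carrier (der_piece L s)"
  note \<delta> = der_carrierD [OF this [unfolded der_piece_def, simplified]]
  note sub [simp] = subgroup.mem_carrier [OF component_subgroup]
  have "(\<lambda>x\<in>carrier L. inv (\<delta> x)) \<in> der_carrier L s"
    by (rule der_carrierI)
      (auto simp: \<delta>(1,2,4) bracket_closed bracket_inv inv_mult
        intro!: subgroup.m_inv_closed [OF component_subgroup] \<delta>(3))
  then show "\<exists>\<epsilon>\<in>carrier (der_piece L s). \<epsilon> \<otimes>\<^bsub>der_piece L s\<^esub> \<delta> = \<one>\<^bsub>der_piece L s\<^esub>"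
    by (intro bexI [of _ "\<lambda>x\<in>carrier L. inv (\<delta> x)"])
      (auto simp: der_piece_def \<delta> intro!: restrict_ext)
  show "\<one>\<^bsub>der_piece L s\<^esub> \<otimes>\<^bsub>der_piece L s\<^esub> \<delta> = \<delta>"
    using \<delta>(1,5) by (auto simp: der_piece_def intro!: extensionalityI [of _ "carrier L"])
next
  fix \<delta> \<epsilon> \<zeta>
  assume "\<delta> \<in> carrier (der_piece L s)" "\<epsilon> \<in> carrier (der_piece L s)" "\<zeta> \<in> carrier (der_piece L s)"
  then show "\<delta> \<otimes>\<^bsub>der_piece L s\<^esub> \<epsilon> \<otimes>\<^bsub>der_piece L s\<^esub> \<zeta> =
      \<delta> \<otimes>\<^bsub>der_piece L s\<^esub> (\<epsilon> \<otimes>\<^bsub>der_piece L s\<^esub> \<zeta>)"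
    by (auto simp: der_piece_def der_carrierD(1) m_assoc intro!: restrict_ext)
qed

lemma Der_carrier:
  "carrier (Der L) = {\<delta> \<in> \<Pi>\<^sub>E s\<in>{1..}. der_carrier L s.
    finite {s \<in> {1..}. \<delta> s \<noteq> (\<lambda>x\<in>carrier L. \<one>)}}"
  by (simp add: Der_def carrier_sum_group der_piece_group) (simp add: der_piece_def)

end

lemma (in N_series) gr_graded_bilinear: "graded_bilinear (gr G K)"
  by (intro graded_bilinear.intro graded_bilinear_axioms.intro gr_comm_group gr_bracket_closed
      gr_bracket_mult_left gr_bracket_mult_right gr_component_subgroup)

section \<open>The Johnson homomorphism\<close>

text \<open>Each \<open>\<phi> g\<close> is bijective because the inverse of g acts as its inverse,
  which leaves only the algebraic laws to check; extensionality is what \<open>Bij\<close> asks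
  for.\<close>

lemma group_actionI:
  assumes "group G"
    and "\<And>g. g \<in> carrier G \<Longrightarrow> \<phi> g \<in> extensional E"
    and closed: "\<And>g x. \<lbrakk>g \<in> carrier G; x \<in> E\<rbrakk> \<Longrightarrow> \<phi> g x \<in> E"
    and one: "\<And>x. x \<in> E \<Longrightarrow> \<phi> \<one>\<^bsub>G\<^esub> x = x"
    and mult: "\<And>g h x. \<lbrakk>g \<in> carrier G; h \<in> carrier G; x \<in> E\<rbrakk> \<Longrightarrow> \<phi> (g \<otimes>\<^bsub>G\<^esub> h) x = \<phi> g (\<phi> h x)"
  shows "group_action G E \<phi>"
proof -
  interpret group G by fact
  have Bij: "\<phi> g \<in> Bij E" if g: "g \<in> carrier G" for g
  proof -
    have "bij_betw (\<phi> g) E E"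
    proof (rule bij_betwI)
      show "\<phi> g \<in> E \<rightarrow> E" "\<phi> (inv\<^bsub>G\<^esub> g) \<in> E \<rightarrow> E"
        using closed g by auto
      fix x assume "x \<in> E"
      then show "\<phi> (inv\<^bsub>G\<^esub> g) (\<phi> g x) = x" "\<phi> g (\<phi> (inv\<^bsub>G\<^esub> g) x) = x"
        using mult [of "inv\<^bsub>G\<^esub> g" g x] mult [of g "inv\<^bsub>G\<^esub> g" x] one g by simp_all
    qed
    then show ?thesis
      using assms(2) [OF g] by (simp add: Bij_def)
  qed
  have "\<phi> \<in> hom G (BijGroup E)"
  proof (rule homI)
    fix g h assume gh: "g \<in> carrier G" "h \<in> carrier G"
    then have "\<phi> (g \<otimes>\<^bsub>G\<^esub> h) = compose E (\<phi> g) (\<phi> h)"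
      using mult assms(2) by (intro extensionalityI [of _ E]) (auto simp: compose_def)
    then show "\<phi> (g \<otimes>\<^bsub>G\<^esub> h) = \<phi> g \<otimes>\<^bsub>BijGroup E\<^esub> \<phi> h"
      using Bij gh by (simp add: BijGroup_def)
  qed (use Bij in \<open>simp add: BijGroup_def\<close>)
  then show ?thesis
    by (simp add: group_action_def group_hom_def group_hom_axioms_def group_BijGroup is_group)
qed

text \<open>The action in a single degree, named so that computations take place on one coset before
  the direct sum is assembled; \<open>act_Torelli_piece\<close> serves the same purpose.\<close>

definition act_Gamma_piece ::
    "('a, 'b) monoid_scheme \<Rightarrow> ('a \<Rightarrow> 'a) set \<Rightarrow> nat \<Rightarrow> 'a set \<Rightarrow> 'a set" where
  "act_Gamma_piece G S t X = the_elem ((\<lambda>(\<sigma>, g). lower_central G (Suc t) #>\<^bsub>G\<^esub> \<sigma> g) ` (S \<times> X))"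

definition act_Torelli_piece ::
    "('a, 'b) monoid_scheme \<Rightarrow> ('a \<Rightarrow> 'a) set \<Rightarrow> nat \<Rightarrow> ('a \<Rightarrow> 'a) set \<Rightarrow> ('a \<Rightarrow> 'a) set" where
  "act_Torelli_piece G S s A =
    the_elem ((\<lambda>(\<sigma>, \<alpha>). johnson_filtration G (Suc s) #>\<^bsub>AutoGroup G\<^esub>
      (\<sigma> \<otimes>\<^bsub>AutoGroup G\<^esub> \<alpha> \<otimes>\<^bsub>AutoGroup G\<^esub> inv\<^bsub>AutoGroup G\<^esub> \<sigma>)) ` (S \<times> A))"

context group
begin

section \<open>Both filtrations are N-series\<close>

lemma lower_central_N_series: "N_series G (lower_central G)"
  by (intro N_series.intro normal_series.intro normal_series_axioms.intro N_series_axioms.intro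
      is_group lower_central_normal lower_central_Suc commutator_lower_central)

interpretation \<Gamma>: N_series G "lower_central G"
  by (rule lower_central_N_series)

text \<open>The estimate as a rewrite rule: an automorphism in step s may be erased in front of an
  element of degree t when computing modulo degree s + t or less.\<close>

lemma johnson_filtration_coset:
  assumes "\<alpha> \<in> johnson_filtration G s" "x \<in> lower_central G t" "t \<ge> 1" "n \<le> s + t"
  shows "lower_central G n #> \<alpha> x = lower_central G n #> x"
proof -
  have "\<alpha> x \<otimes> inv x \<in> lower_central G n"
    using johnson_filtration_lower_central [OF assms(1-3)] \<Gamma>.series_antimono [OF assms(4)] by blast
  then show ?thesis
    using assms(2) AutoGroup_closed [OF johnson_filtrationD(1) [OF assms(1)]]
    by (simp add: \<Gamma>.coset_eq_iff)
qed

lemma johnson_filtrationI: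
  assumes "\<alpha> \<in> carrier (AutoGroup G)"
    and "\<And>x. x \<in> carrier G \<Longrightarrow> lower_central G (Suc s) #> \<alpha> x = lower_central G (Suc s) #> x"
  shows "\<alpha> \<in> johnson_filtration G s"
  using assms AutoGroup_closed [OF assms(1)] \<Gamma>.coset_eq_iff
  by (auto simp: johnson_filtration_def)

lemma johnson_filtration_0: "johnson_filtration G 0 = carrier (AutoGroup G)"
  by (auto simp: johnson_filtration_def AutoGroup_closed)

lemma AutoGroup_coset:
  assumes "\<sigma> \<in> carrier (AutoGroup G)" "x \<in> carrier G" "y \<in> carrier G"
    and "lower_central G n #> x = lower_central G n #> y"
  shows "lower_central G n #> \<sigma> x = lower_central G n #> \<sigma> y"
  using assms AutoGroup_lower_central [OF assms(1), of "x \<otimes> inv y" n] AutoGroup_closed [OF assms(1)]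
  by (simp add: \<Gamma>.coset_eq_iff AutoGroup_mult AutoGroup_inv)

text \<open>F^s is the kernel of the action of Aut(G) on G / Gamma^(s+1). Accordingly each closure
  property is checked as a congruence \<alpha>(x) = x modulo
  \<open>lower_central G (Suc s)\<close>.\<close>

lemma johnson_filtration_normal: "johnson_filtration G s \<lhd> AutoGroup G"
proof -
  interpret A: group "AutoGroup G" by (rule AutoGroup)
  note D = johnson_filtrationD(1) johnson_filtration_coset [where t = 1 and n = "Suc s" and s = s]
  have "subgroup (johnson_filtration G s) (AutoGroup G)"
  proof (rule A.subgroupI)
    have "\<one>\<^bsub>AutoGroup G\<^esub> \<in> johnson_filtration G s"
      by (rule johnson_filtrationI) simp_all
    then show "johnson_filtration G s \<noteq> {}" by blast
  next
    fix \<alpha> assume \<alpha>: "\<alpha> \<in> johnson_filtration G s"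
    then have \<alpha>': "\<alpha> \<in> carrier (AutoGroup G)" by (rule D)
    show "inv\<^bsub>AutoGroup G\<^esub> \<alpha> \<in> johnson_filtration G s"
    proof (rule johnson_filtrationI)
      fix x assume x: "x \<in> carrier G"
      show "lower_central G (Suc s) #> (inv\<^bsub>AutoGroup G\<^esub> \<alpha>) x = lower_central G (Suc s) #> x"
        using D(2) [OF \<alpha>, of "(inv\<^bsub>AutoGroup G\<^esub> \<alpha>) x"] \<alpha>' x
          AutoGroup_closed [OF AutoGroup_inv_closed [OF \<alpha>'] x] by simp
    qed (use \<alpha>' in simp)
  next
    fix \<alpha> \<beta> assume \<alpha>: "\<alpha> \<in> johnson_filtration G s" and \<beta>: "\<beta> \<in> johnson_filtration G s"
    then have \<alpha>': "\<alpha> \<in> carrier (AutoGroup G)" and \<beta>': "\<beta> \<in> carrier (AutoGroup G)"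
      by (auto intro: D)
    show "\<alpha> \<otimes>\<^bsub>AutoGroup G\<^esub> \<beta> \<in> johnson_filtration G s"
    proof (rule johnson_filtrationI)
      fix x assume x: "x \<in> carrier G"
      show "lower_central G (Suc s) #> (\<alpha> \<otimes>\<^bsub>AutoGroup G\<^esub> \<beta>) x = lower_central G (Suc s) #> x"
        using D(2) [OF \<alpha>, of "\<beta> x"] D(2) [OF \<beta>, of x] \<alpha>' \<beta>' x AutoGroup_closed [OF \<beta>' x] by simp
    qed (use \<alpha>' \<beta>' in simp)
  qed (auto intro: D)
  then show ?thesis
  proof (rule A.normal_invI)
    fix \<sigma> \<alpha> assume \<sigma>: "\<sigma> \<in> carrier (AutoGroup G)" and \<alpha>: "\<alpha> \<in> johnson_filtration G s"
    then have \<alpha>': "\<alpha> \<in> carrier (AutoGroup G)" by (auto intro: D)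
    show "\<sigma> \<otimes>\<^bsub>AutoGroup G\<^esub> \<alpha> \<otimes>\<^bsub>AutoGroup G\<^esub> inv\<^bsub>AutoGroup G\<^esub> \<sigma> \<in> johnson_filtration G s"
    proof (rule johnson_filtrationI)
      fix x assume x: "x \<in> carrier G"
      define y where "y = (inv\<^bsub>AutoGroup G\<^esub> \<sigma>) x"
      have y: "y \<in> carrier G"
        unfolding y_def by (rule AutoGroup_closed [OF AutoGroup_inv_closed [OF \<sigma>] x])
      have "lower_central G (Suc s) #> \<sigma> (\<alpha> y) = lower_central G (Suc s) #> \<sigma> y"
        by (rule AutoGroup_coset [OF \<sigma> AutoGroup_closed [OF \<alpha>' y] y]) (use D(2) [OF \<alpha>] y in simp)
      then show "lower_central G (Suc s) #> (\<sigma> \<otimes>\<^bsub>AutoGroup G\<^esub> \<alpha> \<otimes>\<^bsub>AutoGroup G\<^esub> inv\<^bsub>AutoGroup G\<^esub> \<sigma>) x =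
          lower_central G (Suc s) #> x"
        using \<sigma> \<alpha>' x y by (simp add: y_def)
    qed (use \<sigma> \<alpha>' in simp)
  qed
qed

lemma johnson_filtration_normal_series: "normal_series (AutoGroup G) (johnson_filtration G)"
proof (intro normal_series.intro normal_series_axioms.intro AutoGroup johnson_filtration_normal)
  fix n show "johnson_filtration G (Suc n) \<subseteq> johnson_filtration G n"
    using \<Gamma>.Suc_subset unfolding johnson_filtration_def by blast
qed

text \<open>With \<alpha>(y) = c y and \<beta>(y) = d y, modulo degree s + t + 1 the element
  \<alpha>(\<beta>(y)) becomes d c y and \<beta>(\<alpha>(y)) becomes c d y: \<alpha> fixes d and
  \<beta> fixes c at this depth. The elements c and d commute, their degrees adding up to s + t +
  2.\<close>

lemma johnson_filtration_commutator:
  assumes \<alpha>: "\<alpha> \<in> johnson_filtration G s" and \<beta>: "\<beta> \<in> johnson_filtration G t"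
  shows "commutator (AutoGroup G) \<alpha> \<beta> \<in> johnson_filtration G (s + t)"
proof (rule johnson_filtrationI)
  interpret A: group "AutoGroup G" by (rule AutoGroup)
  have \<alpha>': "\<alpha> \<in> carrier (AutoGroup G)" and \<beta>': "\<beta> \<in> carrier (AutoGroup G)"
    using assms johnson_filtrationD by blast+
  then show "commutator (AutoGroup G) \<alpha> \<beta> \<in> carrier (AutoGroup G)"
    by simp
  let ?N = "lower_central G (Suc (s + t))"
  fix x assume x: "x \<in> carrier G"
  \<comment> \<open>With x = \<beta>(\<alpha>(y)) the commutator sends x to \<alpha>(\<beta>(y)), so
    it remains to compare the two orders of composition at y, without inverses.\<close>
  define y where "y = (inv\<^bsub>AutoGroup G\<^esub> \<alpha>) ((inv\<^bsub>AutoGroup G\<^esub> \<beta>) x)"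
  have y: "y \<in> carrier G"
    unfolding y_def
    by (rule AutoGroup_closed [OF AutoGroup_inv_closed [OF \<alpha>']
          AutoGroup_closed [OF AutoGroup_inv_closed [OF \<beta>'] x]])
  note cl = AutoGroup_closed [OF \<alpha>'] AutoGroup_closed [OF \<beta>']
  have x_eq: "x = \<beta> (\<alpha> y)"
    using \<alpha>' \<beta>' x AutoGroup_closed [OF AutoGroup_inv_closed [OF \<beta>'] x] by (simp add: y_def)
  have eq: "commutator (AutoGroup G) \<alpha> \<beta> x = \<alpha> (\<beta> y)"
    using \<alpha>' \<beta>' x AutoGroup_closed [OF AutoGroup_inv_closed [OF \<beta>'] x] y
    by (simp add: commutator_def y_def)
  define c where "c = \<alpha> y \<otimes> inv y"
  define d where "d = \<beta> y \<otimes> inv y"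
  have c: "c \<in> lower_central G (Suc s)" and d: "d \<in> lower_central G (Suc t)"
    unfolding c_def d_def using \<alpha> \<beta> y by (auto intro: johnson_filtrationD(2))
  have cG [simp]: "c \<in> carrier G" "d \<in> carrier G"
    using c d by auto
  have \<alpha>y: "\<alpha> y = c \<otimes> y" and \<beta>y: "\<beta> y = d \<otimes> y"
    using y cl by (simp_all add: c_def d_def m_assoc)
  have "?N #> \<alpha> (\<beta> y) = (?N #> \<alpha> d) <#> (?N #> (c \<otimes> y))"
    using \<alpha>' y cl \<beta>y \<alpha>y by (simp add: AutoGroup_mult flip: \<Gamma>.coset_mult)
  also have "?N #> \<alpha> d = ?N #> d"
    by (rule johnson_filtration_coset [OF \<alpha> d]) auto
  also have "(?N #> d) <#> (?N #> (c \<otimes> y)) = (?N #> (d \<otimes> c)) <#> (?N #> y)"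
    using y by (simp add: m_assoc flip: \<Gamma>.coset_mult)
  also have "?N #> (d \<otimes> c) = ?N #> (c \<otimes> d)"
    by (rule \<Gamma>.coset_commute [OF d c]) auto
  also have "(?N #> (c \<otimes> d)) <#> (?N #> y) = (?N #> c) <#> (?N #> (d \<otimes> y))"
    using y by (simp add: m_assoc flip: \<Gamma>.coset_mult)
  also have "?N #> c = ?N #> \<beta> c"
    by (rule johnson_filtration_coset [OF \<beta> c, symmetric]) auto
  also have "(?N #> \<beta> c) <#> (?N #> (d \<otimes> y)) = ?N #> x"
    using \<beta>' y cl \<beta>y \<alpha>y by (simp add: x_eq AutoGroup_mult flip: \<Gamma>.coset_mult)
  finally show "?N #> commutator (AutoGroup G) \<alpha> \<beta> x = ?N #> x"
    by (simp only: eq)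
qed

lemma johnson_filtration_N_series: "N_series (AutoGroup G) (johnson_filtration G)"
  by (intro N_series.intro N_series_axioms.intro johnson_filtration_normal_series
      johnson_filtration_commutator)

section \<open>The Johnson map on single cosets\<close>

interpretation F: N_series "AutoGroup G" "johnson_filtration G"
  by (rule johnson_filtration_N_series)

text \<open>Replace \<alpha> by \<beta> \<alpha> and x by n x, with \<beta> and n one step deeper.
  Modulo degree s + t + 1, \<beta> acts trivially on degree t and \<alpha> fixes n, so the value
  changes only by conjugation with n, which is trivial there.\<close>

lemma johnson_piece_coset:
  assumes \<alpha>: "\<alpha> \<in> johnson_filtration G s" and x: "x \<in> lower_central G t" and t: "t \<ge> 1"
  shows "johnson_piece G s t (johnson_filtration G (Suc s) #>\<^bsub>AutoGroup G\<^esub> \<alpha>) (lower_central G (Suc t) #> x) =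
    lower_central G (Suc (s + t)) #> (\<alpha> x \<otimes> inv x)"
proof -
  let ?N = "lower_central G (Suc (s + t))"
  have "?N #> (\<alpha>' x' \<otimes> inv x') = ?N #> (\<alpha> x \<otimes> inv x)"
    if \<alpha>': "\<alpha>' \<in> johnson_filtration G (Suc s) #>\<^bsub>AutoGroup G\<^esub> \<alpha>"
      and x': "x' \<in> lower_central G (Suc t) #> x" for \<alpha>' x'
  proof -
    obtain \<beta> where \<beta>: "\<beta> \<in> johnson_filtration G (Suc s)" "\<alpha>' = \<beta> \<otimes>\<^bsub>AutoGroup G\<^esub> \<alpha>"
      using \<alpha>' by (auto simp: r_coset_def)
    obtain n where n: "n \<in> lower_central G (Suc t)" "x' = n \<otimes> x"
      using x' unfolding r_coset_def by blast
    have \<alpha>A: "\<alpha> \<in> carrier (AutoGroup G)" and \<beta>A: "\<beta> \<in> carrier (AutoGroup G)"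
      using \<alpha> \<beta> johnson_filtrationD by blast+
    have [simp]: "x \<in> carrier G" "n \<in> carrier G"
      using x n by auto
    note cl [simp] = AutoGroup_closed [OF \<alpha>A] AutoGroup_closed [OF \<beta>A]
    have x't: "x' \<in> lower_central G t"
      using n x \<Gamma>.Suc_subset by (auto intro!: \<Gamma>.series_mult_closed)
    then have [simp]: "x' \<in> carrier G" by simp
    have "?N #> (\<alpha>' x' \<otimes> inv x') = (?N #> \<beta> (\<alpha> x')) <#> (?N #> inv x')"
      using \<alpha>A \<beta>A by (simp add: \<beta> flip: \<Gamma>.coset_mult)
    also have "?N #> \<beta> (\<alpha> x') = ?N #> \<alpha> x'"
      by (rule johnson_filtration_coset [OF \<beta>(1) AutoGroup_lower_central [OF \<alpha>A x't] t]) simp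
    also have "\<dots> = (?N #> \<alpha> n) <#> (?N #> \<alpha> x)"
      using \<alpha>A by (simp add: n AutoGroup_mult flip: \<Gamma>.coset_mult)
    also have "?N #> \<alpha> n = ?N #> n"
      by (rule johnson_filtration_coset [OF \<alpha> n(1)]) auto
    also have "(?N #> n) <#> (?N #> \<alpha> x) <#> (?N #> inv x') = ?N #> (n \<otimes> (\<alpha> x \<otimes> inv x) \<otimes> inv n)"
      by (simp add: n group_normalize flip: \<Gamma>.coset_mult)
    also have "\<dots> = ?N #> (\<alpha> x \<otimes> inv x)"
      by (rule \<Gamma>.coset_conj [OF n(1) johnson_filtration_lower_central [OF \<alpha> x t]]) (use t in auto)
    finally show ?thesis .
  qed
  then show ?thesis
    unfolding johnson_piece_def
    by (rule the_elem_image_pair [OF F.coset_nonempty [OF \<alpha>] \<Gamma>.coset_nonempty [OF x]])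
qed

lemma johnson_piece_closed:
  assumes "A \<in> carrier (gr_piece (AutoGroup G) (johnson_filtration G) s)"
    and "X \<in> carrier (gr_piece G (lower_central G) t)" "t \<ge> 1"
  shows "johnson_piece G s t A X \<in> carrier (gr_piece G (lower_central G) (s + t))"
proof -
  obtain \<alpha> where "\<alpha> \<in> johnson_filtration G s" "A = johnson_filtration G (Suc s) #>\<^bsub>AutoGroup G\<^esub> \<alpha>"
    using F.gr_piece_repr_ex [OF assms(1)] .
  moreover obtain x where "x \<in> lower_central G t" "X = lower_central G (Suc t) #> x"
    using \<Gamma>.gr_piece_repr_ex [OF assms(2)] .
  ultimately show ?thesis
    using assms(3) johnson_filtration_lower_central
    by (simp add: johnson_piece_coset \<Gamma>.coset_in_gr_piece del: lower_central.simps)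
qed

text \<open>The map x to \<alpha>(x) x^-1 is a crossed homomorphism: its value at x y is its value
  at x times the x-conjugate of its value at y. The conjugation is trivial at this depth.\<close>

lemma johnson_piece_mult:
  assumes "A \<in> carrier (gr_piece (AutoGroup G) (johnson_filtration G) s)"
    and "X \<in> carrier (gr_piece G (lower_central G) t)" "Y \<in> carrier (gr_piece G (lower_central G) t)"
    and s: "s \<ge> 1" and t: "t \<ge> 1"
  shows "johnson_piece G s t A (X \<otimes>\<^bsub>gr_piece G (lower_central G) t\<^esub> Y) =
    johnson_piece G s t A X \<otimes>\<^bsub>gr_piece G (lower_central G) (s + t)\<^esub> johnson_piece G s t A Y"
proof -
  let ?N = "lower_central G (Suc (s + t))"
  obtain \<alpha> where \<alpha>: "\<alpha> \<in> johnson_filtration G s" "A = johnson_filtration G (Suc s) #>\<^bsub>AutoGroup G\<^esub> \<alpha>"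
    using F.gr_piece_repr_ex [OF assms(1)] .
  obtain x where x: "x \<in> lower_central G t" "X = lower_central G (Suc t) #> x"
    using \<Gamma>.gr_piece_repr_ex [OF assms(2)] .
  obtain y where y: "y \<in> lower_central G t" "Y = lower_central G (Suc t) #> y"
    using \<Gamma>.gr_piece_repr_ex [OF assms(3)] .
  have \<alpha>A: "\<alpha> \<in> carrier (AutoGroup G)"
    using \<alpha> johnson_filtrationD by blast
  have [simp]: "x \<in> carrier G" "y \<in> carrier G" using x y by auto
  note cl [simp] = AutoGroup_closed [OF \<alpha>A]
  have XY: "X \<otimes>\<^bsub>gr_piece G (lower_central G) t\<^esub> Y = lower_central G (Suc t) #> (x \<otimes> y)"
    by (simp add: x y \<Gamma>.gr_piece_mult flip: \<Gamma>.coset_mult)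
  have xy: "x \<otimes> y \<in> lower_central G t" using x y by simp
  have "?N #> (\<alpha> (x \<otimes> y) \<otimes> inv (x \<otimes> y)) =
      (?N #> (\<alpha> x \<otimes> inv x)) <#> (?N #> (x \<otimes> (\<alpha> y \<otimes> inv y) \<otimes> inv x))"
    using \<alpha>A by (simp add: AutoGroup_mult group_normalize flip: \<Gamma>.coset_mult)
  also have "?N #> (x \<otimes> (\<alpha> y \<otimes> inv y) \<otimes> inv x) = ?N #> (\<alpha> y \<otimes> inv y)"
    by (rule \<Gamma>.coset_conj [OF x(1) johnson_filtration_lower_central [OF \<alpha>(1) y(1) t]]) (use s t in auto)
  finally show ?thesis
    unfolding XY using \<alpha>(1) x(1) y(1) xy t
    by (simp add: \<alpha>(2) x(2) y(2) johnson_piece_coset \<Gamma>.gr_piece_mult del: lower_central.simps)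
qed

lemma johnson_piece_one:
  assumes "A \<in> carrier (gr_piece (AutoGroup G) (johnson_filtration G) s)"
    and "X \<in> carrier (gr_piece G (lower_central G) t)" "t \<ge> 1"
  shows "johnson_piece G s t A (lower_central G (Suc t)) = lower_central G (Suc (s + t))"
    and "johnson_piece G s t (johnson_filtration G (Suc s)) X = lower_central G (Suc (s + t))"
proof -
  obtain \<alpha> where \<alpha>: "\<alpha> \<in> johnson_filtration G s" "A = johnson_filtration G (Suc s) #>\<^bsub>AutoGroup G\<^esub> \<alpha>"
    using F.gr_piece_repr_ex [OF assms(1)] .
  obtain x where x: "x \<in> lower_central G t" "X = lower_central G (Suc t) #> x"
    using \<Gamma>.gr_piece_repr_ex [OF assms(2)] .
  interpret \<alpha>: group_hom G G \<alpha>
    using \<alpha> by (intro AutoGroup_hom johnson_filtrationD)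
  show "johnson_piece G s t A (lower_central G (Suc t)) = lower_central G (Suc (s + t))"
    using johnson_piece_coset [OF \<alpha>(1), of \<one> t] assms(3)
    by (simp add: \<alpha>(2) \<Gamma>.coset_member del: lower_central.simps)
  show "johnson_piece G s t (johnson_filtration G (Suc s)) X = lower_central G (Suc (s + t))"
    using johnson_piece_coset [of "\<one>\<^bsub>AutoGroup G\<^esub>" s x t] assms(3) x
    by (simp add: \<Gamma>.coset_member F.coset_member del: lower_central.simps)
qed

text \<open>Leibniz rule in single degrees. After \<open>coset_commutator_perturb\<close> the last
  factor (x, y) cancels against the inverse in \<alpha>(w) w^-1 for w = (x, y).\<close>

lemma johnson_piece_bracket:
  assumes "A \<in> carrier (gr_piece (AutoGroup G) (johnson_filtration G) s)"
    and "X \<in> carrier (gr_piece G (lower_central G) i)" "Y \<in> carrier (gr_piece G (lower_central G) j)"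
    and s: "s \<ge> 1" and i: "i \<ge> 1" and j: "j \<ge> 1"
  shows "johnson_piece G s (i + j) A (gr_piece_bracket G (lower_central G) i j X Y) =
    gr_piece_bracket G (lower_central G) (s + i) j (johnson_piece G s i A X) Y
      \<otimes>\<^bsub>gr_piece G (lower_central G) (s + i + j)\<^esub>
    gr_piece_bracket G (lower_central G) i (s + j) X (johnson_piece G s j A Y)"
proof -
  let ?N = "lower_central G (Suc (s + i + j))"
  obtain \<alpha> where \<alpha>: "\<alpha> \<in> johnson_filtration G s" "A = johnson_filtration G (Suc s) #>\<^bsub>AutoGroup G\<^esub> \<alpha>"
    using F.gr_piece_repr_ex [OF assms(1)] .
  obtain x where x: "x \<in> lower_central G i" "X = lower_central G (Suc i) #> x"
    using \<Gamma>.gr_piece_repr_ex [OF assms(2)] .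
  obtain y where y: "y \<in> lower_central G j" "Y = lower_central G (Suc j) #> y"
    using \<Gamma>.gr_piece_repr_ex [OF assms(3)] .
  define c where "c = \<alpha> x \<otimes> inv x"
  define d where "d = \<alpha> y \<otimes> inv y"
  have \<alpha>A: "\<alpha> \<in> carrier (AutoGroup G)"
    using \<alpha> johnson_filtrationD by blast
  have [simp]: "x \<in> carrier G" "y \<in> carrier G" using x y by auto
  note cl [simp] = AutoGroup_closed [OF \<alpha>A]
  have c: "c \<in> lower_central G (s + i)" and d: "d \<in> lower_central G (s + j)"
    unfolding c_def d_def using \<alpha> x y i j by (auto intro: johnson_filtration_lower_central)
  have [simp]: "c \<in> carrier G" "d \<in> carrier G" using c d by auto
  have xy: "commutator G x y \<in> lower_central G (i + j)"
    using x y i j by (intro \<Gamma>.commutator_series)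
  have "\<alpha> (commutator G x y) = commutator G (c \<otimes> x) (d \<otimes> y)"
    by (simp add: AutoGroup_commutator [OF \<alpha>A] c_def d_def m_assoc)
  then have "?N #> (\<alpha> (commutator G x y) \<otimes> inv (commutator G x y)) =
      (?N #> commutator G (c \<otimes> x) (d \<otimes> y)) <#> (?N #> inv (commutator G x y))"
    by (simp add: \<Gamma>.coset_mult)
  also have "?N #> commutator G (c \<otimes> x) (d \<otimes> y) =
      ?N #> (commutator G c y \<otimes> commutator G x d \<otimes> commutator G x y)"
    by (rule \<Gamma>.coset_commutator_perturb [OF c x(1) d y(1) s i j])
  also have "\<dots> <#> (?N #> inv (commutator G x y)) = (?N #> commutator G c y) <#> (?N #> commutator G x d)"
    by (simp add: m_assoc flip: \<Gamma>.coset_mult)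
  finally have eq: "?N #> (\<alpha> (commutator G x y) \<otimes> inv (commutator G x y)) =
    (?N #> commutator G c y) <#> (?N #> commutator G x d)" .
  have "johnson_piece G s (i + j) A (gr_piece_bracket G (lower_central G) i j X Y) =
      ?N #> (\<alpha> (commutator G x y) \<otimes> inv (commutator G x y))"
    using johnson_piece_coset [OF \<alpha>(1) xy] i j
    by (simp add: x y \<alpha>(2) \<Gamma>.gr_piece_bracket_coset add.assoc del: lower_central.simps)
  moreover have "gr_piece_bracket G (lower_central G) (s + i) j (johnson_piece G s i A X) Y =
      ?N #> commutator G c y"
    unfolding x(2) y(2) \<alpha>(2) johnson_piece_coset [OF \<alpha>(1) x(1) i] c_def [symmetric]
    by (rule \<Gamma>.gr_piece_bracket_coset [OF c y(1)]) (use i j in auto)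
  moreover have "gr_piece_bracket G (lower_central G) i (s + j) X (johnson_piece G s j A Y) =
      ?N #> commutator G x d"
    unfolding x(2) y(2) \<alpha>(2) johnson_piece_coset [OF \<alpha>(1) y(1) j] d_def [symmetric]
    using \<Gamma>.gr_piece_bracket_coset [OF x(1) d] i j by (simp add: ac_simps del: lower_central.simps)
  ultimately show ?thesis
    by (simp add: eq \<Gamma>.gr_piece_mult)
qed

section \<open>The Johnson map on the direct sum\<close>

interpretation L: graded_bilinear "gr G (lower_central G)"
  by (rule \<Gamma>.gr_graded_bilinear)

lemma johnson_degree_apply:
  assumes "x \<in> carrier (gr G (lower_central G))" "r \<ge> 1"
  shows "johnson_degree G s A x r = (if s < r then johnson_piece G s (r - s) A (x (r - s))
    else lower_central G (Suc r))"
  using assms by (simp add: johnson_degree_def gr_Gamma_def \<Gamma>.gr_piece_one)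

lemma johnson_degree_closed:
  assumes A: "A \<in> carrier (gr_piece (AutoGroup G) (johnson_filtration G) s)"
    and x: "x \<in> carrier (gr G (lower_central G))"
  shows "johnson_degree G s A x \<in> carrier (gr G (lower_central G))"
proof -
  obtain N where N: "\<forall>n>N. x n = lower_central G (Suc n)"
    using \<Gamma>.gr_eventually_one [OF x] by blast
  show ?thesis
  proof (rule \<Gamma>.gr_carrierI [where N = "s + N"])
    show "johnson_degree G s A x \<in> extensional {1..}"
      using x by (simp add: johnson_degree_def gr_Gamma_def)
  next
    fix r :: nat assume r: "r \<ge> 1"
    have "johnson_piece G s (r - s) A (x (r - s)) \<in> carrier (gr_piece G (lower_central G) r)" if "s < r"
      using johnson_piece_closed [OF A \<Gamma>.gr_component_carrier [OF x], of "r - s"] that by simp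
    then show "johnson_degree G s A x r \<in> carrier (gr_piece G (lower_central G) r)"
      using r group.is_monoid [OF \<Gamma>.gr_piece_group, THEN monoid.one_closed, of r]
      by (simp add: johnson_degree_apply [OF x r] \<Gamma>.gr_piece_one)
  next
    fix r assume r: "r > s + N"
    then show "johnson_degree G s A x r = lower_central G (Suc r)"
      using johnson_piece_one(1) [OF A \<Gamma>.gr_component_carrier [OF x], of "r - s"] N
      by (simp add: johnson_degree_apply [OF x] del: lower_central.simps)
  qed
qed

lemma johnson_degree_bracket:
  assumes A: "A \<in> carrier (gr_piece (AutoGroup G) (johnson_filtration G) s)" and s: "s \<ge> 1"
    and x: "x \<in> carrier (gr G (lower_central G))" and y: "y \<in> carrier (gr G (lower_central G))"
  shows "johnson_degree G s A (lie_bracket (gr G (lower_central G)) x y) =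
    lie_bracket (gr G (lower_central G)) (johnson_degree G s A x) y \<otimes>\<^bsub>gr G (lower_central G)\<^esub>
    lie_bracket (gr G (lower_central G)) x (johnson_degree G s A y)"
proof (rule \<Gamma>.gr_eqI)
  let ?L = "gr G (lower_central G)"
  let ?\<delta> = "johnson_degree G s A"
  have \<delta>x: "?\<delta> x \<in> carrier ?L" and \<delta>y: "?\<delta> y \<in> carrier ?L"
    using johnson_degree_closed [OF A] x y by auto
  show "?\<delta> (lie_bracket ?L x y) \<in> carrier ?L"
    by (intro johnson_degree_closed A L.bracket_closed x y)
  show "lie_bracket ?L (?\<delta> x) y \<otimes>\<^bsub>?L\<^esub> lie_bracket ?L x (?\<delta> y) \<in> carrier ?L"
    by (intro L.m_closed L.bracket_closed \<delta>x \<delta>y x y)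
  fix r :: nat assume r: "r \<ge> 1"
  let ?P = "gr_piece G (lower_central G)"
  let ?b = "gr_piece_bracket G (lower_central G)"
  let ?J = "\<lambda>t. johnson_piece G s t A"
  interpret P: comm_group "?P r" by (rule \<Gamma>.gr_piece_comm_group [OF r])
  note xc = \<Gamma>.gr_component_carrier [OF x] and yc = \<Gamma>.gr_component_carrier [OF y]
  \<comment> \<open>\<open>T1 i\<close> is the bracket of J(x_i) with y_(r-s-i), and
    \<open>T2 i\<close> that of x_i with J(y_(r-s-i)). Both are indexed by the degree i of the
    component of x, so the Leibniz rule applies term by term.\<close>
  define T1 where "T1 = (\<lambda>i. ?b (s + i) (r - s - i) (?J i (x i)) (y (r - s - i)))"
  define T2 where "T2 = (\<lambda>i. ?b i (r - i) (x i) (?J (r - s - i) (y (r - s - i))))"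
  have T1: "T1 i \<in> carrier (?P r)" if "i \<in> {1..<r - s}" for i
  proof -
    from that have "1 \<le> r - s - i" by auto
    then show ?thesis
      using \<Gamma>.gr_piece_bracket_closed [OF johnson_piece_closed [OF A xc, of i] yc, of "r - s - i"] that
      by (simp add: T1_def)
  qed
  have T2: "T2 i \<in> carrier (?P r)" if "i \<in> {1..<r - s}" for i
  proof -
    from that have "1 \<le> r - s - i" "1 \<le> r - i" by auto
    then show ?thesis
      using \<Gamma>.gr_piece_bracket_closed [OF xc johnson_piece_closed [OF A yc], of i "r - s - i"] that
      by (simp add: T2_def)
  qed
  have left: "lie_bracket ?L (?\<delta> x) y r = finprod (?P r) T1 {1..<r - s}"
  proof -
    have "lie_bracket ?L (?\<delta> x) y r = finprod (?P r) (\<lambda>i. ?b i (r - i) (?\<delta> x i) (y (r - i))) {1..<r}"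
      using r by (simp add: \<Gamma>.gr_bracket)
    \<comment> \<open>The bracket is indexed by the degree of J(x), which is s plus the degree of x.
      Indices up to s contribute nothing, since J(x) vanishes there; the others are shifted by
      s.\<close>
    also have "\<dots> = finprod (?P r) (\<lambda>i. T1 (i - s)) ((+) s ` {1..<r - s})"
    proof (rule P.finprod_mono_neutral_cong_right)
      fix i assume "i \<in> {1..<r} - (+) s ` {1..<r - s}"
      then have i: "i \<in> {1..<r}" "i \<le> s"
        using image_eqI [of i "(+) s" "i - s" "{1..<r - s}"] by (auto simp: not_le)
      then show "?b i (r - i) (?\<delta> x i) (y (r - i)) = \<one>\<^bsub>?P r\<^esub>"
        using \<Gamma>.gr_piece_bracket_one(2) [OF xc yc, of i "r - i"] Suc_leI [of 0 "r - i"]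
        by (simp add: johnson_degree_apply [OF x] \<Gamma>.gr_piece_one del: lower_central.simps)
    next
      fix i assume "i \<in> (+) s ` {1..<r - s}"
      then show "?b i (r - i) (?\<delta> x i) (y (r - i)) = T1 (i - s)"
        by (auto simp: johnson_degree_apply [OF x] T1_def)
    qed (use \<Gamma>.gr_bracket_term_closed [OF \<delta>x y] in auto)
    also have "\<dots> = finprod (?P r) T1 {1..<r - s}"
      by (subst P.finprod_reindex) (auto simp: T1 simp del: image_add_atLeastLessThan)
    finally show ?thesis .
  qed
  have right: "lie_bracket ?L x (?\<delta> y) r = finprod (?P r) T2 {1..<r - s}"
  proof -
    have "lie_bracket ?L x (?\<delta> y) r = finprod (?P r) (\<lambda>i. ?b i (r - i) (x i) (?\<delta> y (r - i))) {1..<r}"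
      using r by (simp add: \<Gamma>.gr_bracket)
    \<comment> \<open>Here the index is already the degree of x. Terms with r - i at most s vanish
      because J(y) has no component in those degrees.\<close>
    also have "\<dots> = finprod (?P r) T2 {1..<r - s}"
    proof (rule P.finprod_mono_neutral_cong_right)
      fix i assume "i \<in> {1..<r} - {1..<r - s}"
      then have "i \<in> {1..<r}" "\<not> s < r - i" by auto
      then show "?b i (r - i) (x i) (?\<delta> y (r - i)) = \<one>\<^bsub>?P r\<^esub>"
        using \<Gamma>.gr_piece_bracket_one(1) [OF xc yc, of i "r - i"] Suc_leI [of 0 "r - i"]
        by (simp add: johnson_degree_apply [OF y] \<Gamma>.gr_piece_one del: lower_central.simps)
    next
      fix i assume "i \<in> {1..<r - s}"
      then have "1 \<le> r - i" "s < r - i" "r - i - s = r - s - i" by auto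
      then show "?b i (r - i) (x i) (?\<delta> y (r - i)) = T2 i"
        by (simp only: johnson_degree_apply [OF y] T2_def if_True)
    qed (use \<Gamma>.gr_bracket_term_closed [OF x \<delta>y] in auto)
    finally show ?thesis .
  qed
  have "?\<delta> (lie_bracket ?L x y) r = finprod (?P r) (\<lambda>i. T1 i \<otimes>\<^bsub>?P r\<^esub> T2 i) {1..<r - s}"
  proof (cases "s < r")
    case True
    interpret P': comm_group "?P (r - s)"
      by (rule \<Gamma>.gr_piece_comm_group) (use True in simp)
    have rs: "1 \<le> r - s" "s + (r - s) = r" using True by auto
    \<comment> \<open>Additivity lets J pass through the finite product that forms the bracket in
      degree r - s.\<close>
    have hom: "?J (r - s) \<in> hom (?P (r - s)) (?P r)"
      using johnson_piece_closed [OF A _ rs(1)] johnson_piece_mult [OF A _ _ s rs(1)] rs(2)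
      by (intro homI) auto
    have one: "?J (r - s) \<one>\<^bsub>?P (r - s)\<^esub> = \<one>\<^bsub>?P r\<^esub>"
      using johnson_piece_one(1) [OF A xc rs(1)] rs by (simp add: \<Gamma>.gr_piece_one del: lower_central.simps)
    have "?\<delta> (lie_bracket ?L x y) r = ?J (r - s) (lie_bracket ?L x y (r - s))"
      using True r by (simp add: johnson_degree_apply [OF L.bracket_closed [OF x y]])
    also have "lie_bracket ?L x y (r - s) =
        finprod (?P (r - s)) (\<lambda>i. ?b i (r - s - i) (x i) (y (r - s - i))) {1..<r - s}"
      using rs(1) by (simp add: \<Gamma>.gr_bracket)
    also have "?J (r - s) \<dots> =
        finprod (?P r) (\<lambda>i. ?J (r - s) (?b i (r - s - i) (x i) (y (r - s - i)))) {1..<r - s}"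
      by (rule hom_finprod [OF P'.comm_monoid_axioms P.comm_monoid_axioms hom one])
        (use \<Gamma>.gr_bracket_term_closed [OF x y, where r = "r - s"] in auto)
    also have "\<dots> = finprod (?P r) (\<lambda>i. T1 i \<otimes>\<^bsub>?P r\<^esub> T2 i) {1..<r - s}"
    proof (rule P.finprod_cong')
      fix i assume i: "i \<in> {1..<r - s}"
      then have "1 \<le> r - s - i" "i + (r - s - i) = r - s" "s + i + (r - s - i) = r" "s + (r - s - i) = r - i"
        by auto
      then show "?J (r - s) (?b i (r - s - i) (x i) (y (r - s - i))) = T1 i \<otimes>\<^bsub>?P r\<^esub> T2 i"
        using johnson_piece_bracket [OF A xc yc s, of i "r - s - i"] i by (simp add: T1_def T2_def)
    qed (use T1 T2 in auto)
    finally show ?thesis .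
  next
    \<comment> \<open>For r at most s truncated subtraction makes \<open>{1..<r - s}\<close> empty,
      and J has no component in degree r, so both sides are zero.\<close>
    case False
    then show ?thesis
      using r by (simp add: johnson_degree_apply [OF L.bracket_closed [OF x y]] \<Gamma>.gr_piece_one)
  qed
  also have "\<dots> = finprod (?P r) T1 {1..<r - s} \<otimes>\<^bsub>?P r\<^esub> finprod (?P r) T2 {1..<r - s}"
    by (rule P.finprod_multf) (use T1 T2 in auto)
  finally show "?\<delta> (lie_bracket ?L x y) r =
      (lie_bracket ?L (?\<delta> x) y \<otimes>\<^bsub>?L\<^esub> lie_bracket ?L x (?\<delta> y)) r"
    using r by (simp add: \<Gamma>.gr_mult left right)
qed

lemma johnson_degree_der:
  assumes A: "A \<in> carrier (gr_piece (AutoGroup G) (johnson_filtration G) s)" and s: "s \<ge> 1"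
  shows "johnson_degree G s A \<in> der_carrier (gr G (lower_central G)) s"
proof (rule L.der_carrierI)
  let ?L = "gr G (lower_central G)"
  show "johnson_degree G s A \<in> extensional (carrier ?L)"
    by (simp add: johnson_degree_def gr_Gamma_def)
  show "johnson_degree G s A x \<in> carrier ?L" if "x \<in> carrier ?L" for x
    by (rule johnson_degree_closed [OF A that])
  show "johnson_degree G s A (lie_bracket ?L x y) =
      lie_bracket ?L (johnson_degree G s A x) y \<otimes>\<^bsub>?L\<^esub> lie_bracket ?L x (johnson_degree G s A y)"
    if "x \<in> carrier ?L" "y \<in> carrier ?L" for x y
    by (rule johnson_degree_bracket [OF A s that])
  show "johnson_degree G s A x \<in> component ?L (t + s)" if x: "x \<in> component ?L t" and t: "t \<ge> 1" for x t
  proof -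
    have xL: "x \<in> carrier ?L" using x by (simp add: \<Gamma>.gr_component)
    have "johnson_degree G s A x r = lower_central G (Suc r)" if r: "r \<ge> 1" "r \<noteq> t + s" for r
      using x r johnson_piece_one(1) [OF A \<Gamma>.gr_component_carrier [OF xL], of "r - s"]
      by (simp add: johnson_degree_apply [OF xL] \<Gamma>.gr_component del: lower_central.simps)
    then show ?thesis
      using johnson_degree_closed [OF A xL] by (simp add: \<Gamma>.gr_component del: lower_central.simps)
  qed
  show "johnson_degree G s A (x \<otimes>\<^bsub>?L\<^esub> y) = johnson_degree G s A x \<otimes>\<^bsub>?L\<^esub> johnson_degree G s A y"
    if x: "x \<in> carrier ?L" and y: "y \<in> carrier ?L" for x y
  proof (rule \<Gamma>.gr_eqI)
    fix r :: nat assume r: "r \<ge> 1"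
    let ?P = "gr_piece G (lower_central G)"
    interpret P: group "?P r" by (rule \<Gamma>.gr_piece_group)
    show "johnson_degree G s A (x \<otimes>\<^bsub>?L\<^esub> y) r =
        (johnson_degree G s A x \<otimes>\<^bsub>?L\<^esub> johnson_degree G s A y) r"
    proof (cases "s < r")
      case True
      then show ?thesis
        using r x y johnson_piece_mult [OF A \<Gamma>.gr_component_carrier [OF x]
            \<Gamma>.gr_component_carrier [OF y] s, of "r - s"]
        by (simp add: johnson_degree_apply \<Gamma>.gr_mult [of _ _, THEN fun_cong] Suc_le_eq)
    next
      case False
      then show ?thesis
        using r x y P.r_one [OF P.one_closed, unfolded \<Gamma>.gr_piece_one]
        by (simp add: johnson_degree_apply) (simp add: \<Gamma>.gr_mult johnson_degree_apply \<Gamma>.gr_piece_one)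
    qed
  qed (auto intro: johnson_degree_closed [OF A] x y)
qed

text \<open>\<open>gr_piece\<close> overwrites the carrier of the ambient group, so the pieces are
  the same for \<open>torelli_group G\<close> as for \<open>AutoGroup G\<close>, where the N-series
  results are available.\<close>

lemma Torelli_carrier: "carrier (gr_Torelli G) = carrier (gr (AutoGroup G) (johnson_filtration G))"
proof -
  have "gr_piece (torelli_group G) (johnson_filtration G) = gr_piece (AutoGroup G) (johnson_filtration G)"
    by (simp add: fun_eq_iff gr_piece_def torelli_group_def)
  then show ?thesis
    by (simp add: gr_Torelli_def gr_def gr_sum_def)
qed

text \<open>A trivial coset in degree s gives the zero derivation, so the support of
  \<open>johnson G a\<close> is contained in that of a and is finite.\<close>

lemma johnson_closed:
  assumes "a \<in> carrier (gr_Torelli G)"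
  shows "johnson G a \<in> carrier (Der (gr_Gamma G))"
proof -
  let ?L = "gr G (lower_central G)"
  have a: "a \<in> carrier (gr (AutoGroup G) (johnson_filtration G))"
    using assms by (simp add: Torelli_carrier)
  have "johnson_degree G s (a s) = (\<lambda>x\<in>carrier ?L. \<one>\<^bsub>?L\<^esub>)"
    if "s \<ge> 1" "a s = johnson_filtration G (Suc s)" for s
  proof (rule extensionalityI)
    fix x assume x: "x \<in> carrier ?L"
    have "johnson_degree G s (a s) x = \<one>\<^bsub>?L\<^esub>"
    proof (rule \<Gamma>.gr_eqI)
      fix r :: nat assume r: "r \<ge> 1"
      then show "johnson_degree G s (a s) x r = \<one>\<^bsub>?L\<^esub> r"
        using johnson_piece_one(2) [OF F.gr_component_carrier [OF a that(1)]
            \<Gamma>.gr_component_carrier [OF x], of "r - s"] that(2)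
        by (simp add: johnson_degree_apply [OF x] \<Gamma>.gr_one del: lower_central.simps)
    qed (use johnson_degree_closed [OF F.gr_component_carrier [OF a that(1)] x] in auto)
    then show "johnson_degree G s (a s) x = (\<lambda>x\<in>carrier ?L. \<one>\<^bsub>?L\<^esub>) x"
      using x by simp
  qed (auto simp: johnson_degree_def gr_Gamma_def)
  then have "{s \<in> {1..}. johnson G a s \<noteq> (\<lambda>x\<in>carrier ?L. \<one>\<^bsub>?L\<^esub>)} \<subseteq>
      {s \<in> {1..}. a s \<noteq> johnson_filtration G (Suc s)}"
    using assms by (auto simp: johnson_def)
  moreover have "finite {s \<in> {1..}. a s \<noteq> johnson_filtration G (Suc s)}"
    using a by (simp add: F.gr_carrier)
  ultimately have "finite {s \<in> {1..}. johnson G a s \<noteq> (\<lambda>x\<in>carrier ?L. \<one>\<^bsub>?L\<^esub>)}"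
    by (rule finite_subset)
  moreover have "johnson G a s \<in> der_carrier ?L s" if "s \<ge> 1" for s
    using johnson_degree_der [OF F.gr_component_carrier [OF a that] that] assms that
    by (simp add: johnson_def)
  moreover have "johnson G a \<in> extensional {1..}"
    using assms by (simp add: johnson_def)
  ultimately show ?thesis
    by (simp add: gr_Gamma_def L.Der_carrier PiE_iff)
qed

section \<open>The actions\<close>

abbreviation torelli_coset :: "('a \<Rightarrow> 'a) \<Rightarrow> ('a \<Rightarrow> 'a) set" where
  "torelli_coset \<sigma> \<equiv> johnson_filtration G (Suc 0) #>\<^bsub>AutoGroup G\<^esub> \<sigma>"

lemma A_group: "group (A_group G)"
  unfolding A_group_def by (rule F.gr_piece_group)

lemma A_group_carrier: "carrier (A_group G) = torelli_coset ` carrier (AutoGroup G)"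
  by (simp add: A_group_def F.gr_piece_carrier johnson_filtration_0)

lemma A_group_one: "\<one>\<^bsub>A_group G\<^esub> = torelli_coset \<one>\<^bsub>AutoGroup G\<^esub>"
  by (simp add: A_group_def F.gr_piece_one F.coset_member)

lemma A_group_mult:
  "\<lbrakk>\<sigma> \<in> carrier (AutoGroup G); \<tau> \<in> carrier (AutoGroup G)\<rbrakk>
    \<Longrightarrow> torelli_coset \<sigma> \<otimes>\<^bsub>A_group G\<^esub> torelli_coset \<tau> = torelli_coset (\<sigma> \<otimes>\<^bsub>AutoGroup G\<^esub> \<tau>)"
  by (simp add: A_group_def F.gr_piece_mult F.coset_mult)

lemma A_group_inv:
  assumes "\<sigma> \<in> carrier (AutoGroup G)"
  shows "inv\<^bsub>A_group G\<^esub> (torelli_coset \<sigma>) = torelli_coset (inv\<^bsub>AutoGroup G\<^esub> \<sigma>)"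
proof (rule group.inv_equality [OF A_group])
  show "torelli_coset (inv\<^bsub>AutoGroup G\<^esub> \<sigma>) \<otimes>\<^bsub>A_group G\<^esub> torelli_coset \<sigma> = \<one>\<^bsub>A_group G\<^esub>"
    using assms by (simp add: A_group_mult A_group_one)
qed (use assms in \<open>auto simp: A_group_carrier\<close>)

text \<open>Independence of \<sigma>: the Torelli group acts trivially on every quotient of
  consecutive terms, which is the estimate with s = 1. Independence of g: \<sigma> preserves the
  next term.\<close>

lemma act_Gamma_piece_coset:
  assumes \<sigma>: "\<sigma> \<in> carrier (AutoGroup G)" and g: "g \<in> lower_central G t" and t: "t \<ge> 1"
  shows "act_Gamma_piece G (torelli_coset \<sigma>) t (lower_central G (Suc t) #> g) = lower_central G (Suc t) #> \<sigma> g"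
proof -
  let ?N = "lower_central G (Suc t)"
  have *: "?N #> \<sigma>' g' = ?N #> \<sigma> g" if \<sigma>': "\<sigma>' \<in> torelli_coset \<sigma>" and g': "g' \<in> ?N #> g" for \<sigma>' g'
  proof -
    obtain \<beta> where \<beta>: "\<beta> \<in> johnson_filtration G (Suc 0)" "\<sigma>' = \<beta> \<otimes>\<^bsub>AutoGroup G\<^esub> \<sigma>"
      using \<sigma>' by (auto simp: r_coset_def)
    have g't: "g' \<in> lower_central G t" and eq: "?N #> g = ?N #> g'"
      using \<Gamma>.gr_piece_repr [OF \<Gamma>.coset_in_gr_piece [OF g] g'] by auto
    have "?N #> \<sigma>' g' = ?N #> \<beta> (\<sigma> g')"
      using \<beta> \<sigma> g't by simp
    also have "\<dots> = ?N #> \<sigma> g'"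
      by (rule johnson_filtration_coset [OF \<beta>(1) AutoGroup_lower_central [OF \<sigma> g't] t]) simp
    also have "\<dots> = ?N #> \<sigma> g"
      by (rule AutoGroup_coset [OF \<sigma> _ _ eq [symmetric]]) (use g g't in auto)
    finally show ?thesis .
  qed
  have "\<sigma> \<in> torelli_coset \<sigma>"
    using F.coset_nonempty [of \<sigma> 0] \<sigma> by (simp add: johnson_filtration_0)
  then show ?thesis
    unfolding act_Gamma_piece_def by (rule the_elem_image_pair [OF _ \<Gamma>.coset_nonempty [OF g] *])
qed

lemma act_Gamma_piece_closed:
  assumes "\<sigma> \<in> carrier (AutoGroup G)" "X \<in> carrier (gr_piece G (lower_central G) t)" "t \<ge> 1"
  shows "act_Gamma_piece G (torelli_coset \<sigma>) t X \<in> carrier (gr_piece G (lower_central G) t)"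
proof -
  obtain x where "x \<in> lower_central G t" "X = lower_central G (Suc t) #> x"
    using \<Gamma>.gr_piece_repr_ex [OF assms(2)] .
  then show ?thesis
    using assms AutoGroup_lower_central
    by (simp add: act_Gamma_piece_coset \<Gamma>.coset_in_gr_piece del: lower_central.simps)
qed

lemma act_Gamma_piece_mult:
  assumes \<sigma>: "\<sigma> \<in> carrier (AutoGroup G)" and X: "X \<in> carrier (gr_piece G (lower_central G) t)"
    and Y: "Y \<in> carrier (gr_piece G (lower_central G) t)" and "t \<ge> 1"
  shows "act_Gamma_piece G (torelli_coset \<sigma>) t (X \<otimes>\<^bsub>gr_piece G (lower_central G) t\<^esub> Y) =
    act_Gamma_piece G (torelli_coset \<sigma>) t X \<otimes>\<^bsub>gr_piece G (lower_central G) t\<^esub> act_Gamma_piece G (torelli_coset \<sigma>) t Y"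
proof -
  obtain x where x: "x \<in> lower_central G t" "X = lower_central G (Suc t) #> x"
    using \<Gamma>.gr_piece_repr_ex [OF X] .
  obtain y where y: "y \<in> lower_central G t" "Y = lower_central G (Suc t) #> y"
    using \<Gamma>.gr_piece_repr_ex [OF Y] .
  have "x \<otimes> y \<in> lower_central G t" "x \<in> carrier G" "y \<in> carrier G"
    using x y by auto
  then show ?thesis
    using act_Gamma_piece_coset [OF \<sigma> _ \<open>t \<ge> 1\<close>] x y AutoGroup_closed [OF \<sigma>] AutoGroup_mult [OF \<sigma>]
    by (simp add: \<Gamma>.gr_piece_mult del: lower_central.simps flip: \<Gamma>.coset_mult)
qed

lemma act_Gamma_piece_one:
  assumes "\<sigma> \<in> carrier (AutoGroup G)" "t \<ge> 1"
  shows "act_Gamma_piece G (torelli_coset \<sigma>) t (lower_central G (Suc t)) = lower_central G (Suc t)"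
proof -
  interpret \<sigma>: group_hom G G \<sigma> by (rule AutoGroup_hom [OF assms(1)])
  show ?thesis
    using act_Gamma_piece_coset [OF assms(1) \<Gamma>.series_one_closed assms(2)]
    by (simp add: \<Gamma>.coset_member del: lower_central.simps)
qed

lemma act_Gamma_piece_bracket:
  assumes \<sigma>: "\<sigma> \<in> carrier (AutoGroup G)" and X: "X \<in> carrier (gr_piece G (lower_central G) i)"
    and Y: "Y \<in> carrier (gr_piece G (lower_central G) j)" and ij: "i \<ge> 1" "j \<ge> 1"
  shows "act_Gamma_piece G (torelli_coset \<sigma>) (i + j) (gr_piece_bracket G (lower_central G) i j X Y) =
    gr_piece_bracket G (lower_central G) i j (act_Gamma_piece G (torelli_coset \<sigma>) i X) (act_Gamma_piece G (torelli_coset \<sigma>) j Y)"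
proof -
  obtain x where x: "x \<in> lower_central G i" "X = lower_central G (Suc i) #> x"
    using \<Gamma>.gr_piece_repr_ex [OF X] .
  obtain y where y: "y \<in> lower_central G j" "Y = lower_central G (Suc j) #> y"
    using \<Gamma>.gr_piece_repr_ex [OF Y] .
  have xy: "commutator G x y \<in> lower_central G (i + j)"
    using x y ij by (intro \<Gamma>.commutator_series)
  have "i + j \<ge> 1" using ij by simp
  have "act_Gamma_piece G (torelli_coset \<sigma>) (i + j) (gr_piece_bracket G (lower_central G) i j X Y) =
      lower_central G (Suc (i + j)) #> \<sigma> (commutator G x y)"
    unfolding x(2) y(2) \<Gamma>.gr_piece_bracket_coset [OF x(1) y(1) ij]
    by (rule act_Gamma_piece_coset [OF \<sigma> xy \<open>i + j \<ge> 1\<close>])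
  also have "\<sigma> (commutator G x y) = commutator G (\<sigma> x) (\<sigma> y)"
    using x y by (intro AutoGroup_commutator [OF \<sigma>]) auto
  also have "lower_central G (Suc (i + j)) #> \<dots> = gr_piece_bracket G (lower_central G) i j
      (act_Gamma_piece G (torelli_coset \<sigma>) i X) (act_Gamma_piece G (torelli_coset \<sigma>) j Y)"
    unfolding x(2) y(2) act_Gamma_piece_coset [OF \<sigma> x(1) ij(1)] act_Gamma_piece_coset [OF \<sigma> y(1) ij(2)]
    using AutoGroup_lower_central [OF \<sigma>] x y ij by (simp only: \<Gamma>.gr_piece_bracket_coset)
  finally show ?thesis .
qed

lemma act_Gamma_piece_comp:
  assumes \<sigma>: "\<sigma> \<in> carrier (AutoGroup G)" and \<tau>: "\<tau> \<in> carrier (AutoGroup G)"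
    and X: "X \<in> carrier (gr_piece G (lower_central G) t)" and t: "t \<ge> 1"
  shows "act_Gamma_piece G (torelli_coset (\<sigma> \<otimes>\<^bsub>AutoGroup G\<^esub> \<tau>)) t X =
    act_Gamma_piece G (torelli_coset \<sigma>) t (act_Gamma_piece G (torelli_coset \<tau>) t X)"
proof -
  obtain x where x: "x \<in> lower_central G t" "X = lower_central G (Suc t) #> x"
    using \<Gamma>.gr_piece_repr_ex [OF X] .
  then show ?thesis
    using assms AutoGroup_lower_central [OF \<tau> x(1)]
    by (simp add: act_Gamma_piece_coset del: lower_central.simps)
qed

lemma act_Gamma_piece_id:
  assumes "X \<in> carrier (gr_piece G (lower_central G) t)" "t \<ge> 1"
  shows "act_Gamma_piece G (torelli_coset \<one>\<^bsub>AutoGroup G\<^esub>) t X = X"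
proof -
  obtain x where x: "x \<in> lower_central G t" "X = lower_central G (Suc t) #> x"
    using \<Gamma>.gr_piece_repr_ex [OF assms(1)] .
  then show ?thesis
    using assms by (simp add: act_Gamma_piece_coset del: lower_central.simps)
qed

section \<open>A(G) acts on \<open>gr_Gamma G\<close> by graded Lie automorphisms\<close>

lemma act_Gamma_apply:
  "\<lbrakk>x \<in> carrier (gr G (lower_central G)); t \<ge> 1\<rbrakk> \<Longrightarrow> act_Gamma G S x t = act_Gamma_piece G S t (x t)"
  by (simp add: act_Gamma_def act_Gamma_piece_def gr_Gamma_def)

context
  fixes \<sigma> assumes \<sigma>: "\<sigma> \<in> carrier (AutoGroup G)"
begin

lemma act_Gamma_closed:
  assumes x: "x \<in> carrier (gr G (lower_central G))"
  shows "act_Gamma G (torelli_coset \<sigma>) x \<in> carrier (gr G (lower_central G))"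
proof -
  obtain N where N: "\<forall>n>N. x n = lower_central G (Suc n)"
    using \<Gamma>.gr_eventually_one [OF x] by blast
  show ?thesis
  proof (rule \<Gamma>.gr_carrierI [where N = N])
    show "act_Gamma G (torelli_coset \<sigma>) x \<in> extensional {1..}"
      using x by (simp add: act_Gamma_def gr_Gamma_def)
    show "act_Gamma G (torelli_coset \<sigma>) x n \<in> carrier (gr_piece G (lower_central G) n)" if "n \<ge> 1" for n
      using act_Gamma_piece_closed [OF \<sigma> \<Gamma>.gr_component_carrier [OF x that] that] act_Gamma_apply [OF x that]
      by simp
    show "act_Gamma G (torelli_coset \<sigma>) x n = lower_central G (Suc n)" if "n > N" for n
      using that N act_Gamma_piece_one [OF \<sigma>, of n] act_Gamma_apply [OF x, of n]
      by (simp del: lower_central.simps)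
  qed
qed

lemma act_Gamma_mult:
  assumes x: "x \<in> carrier (gr G (lower_central G))" and y: "y \<in> carrier (gr G (lower_central G))"
  shows "act_Gamma G (torelli_coset \<sigma>) (x \<otimes>\<^bsub>gr G (lower_central G)\<^esub> y) =
    act_Gamma G (torelli_coset \<sigma>) x \<otimes>\<^bsub>gr G (lower_central G)\<^esub> act_Gamma G (torelli_coset \<sigma>) y"
proof (rule \<Gamma>.gr_eqI)
  fix t :: nat assume t: "t \<ge> 1"
  then show "act_Gamma G (torelli_coset \<sigma>) (x \<otimes>\<^bsub>gr G (lower_central G)\<^esub> y) t =
      (act_Gamma G (torelli_coset \<sigma>) x \<otimes>\<^bsub>gr G (lower_central G)\<^esub> act_Gamma G (torelli_coset \<sigma>) y) t"
    using act_Gamma_apply [OF L.m_closed [OF x y] t] act_Gamma_apply [OF x t] act_Gamma_apply [OF y t]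
      act_Gamma_piece_mult [OF \<sigma> \<Gamma>.gr_component_carrier [OF x t] \<Gamma>.gr_component_carrier [OF y t] t]
    by (simp add: \<Gamma>.gr_mult)
qed (auto intro: act_Gamma_closed x y)

lemma act_Gamma_bracket:
  assumes x: "x \<in> carrier (gr G (lower_central G))" and y: "y \<in> carrier (gr G (lower_central G))"
  shows "act_Gamma G (torelli_coset \<sigma>) (lie_bracket (gr G (lower_central G)) x y) =
    lie_bracket (gr G (lower_central G)) (act_Gamma G (torelli_coset \<sigma>) x) (act_Gamma G (torelli_coset \<sigma>) y)"
proof (rule \<Gamma>.gr_eqI)
  let ?P = "gr_piece G (lower_central G)"
  let ?b = "gr_piece_bracket G (lower_central G)"
  note cl = act_Gamma_closed [OF x] act_Gamma_closed [OF y]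
  fix r :: nat assume r: "r \<ge> 1"
  interpret P: comm_group "?P r" by (rule \<Gamma>.gr_piece_comm_group [OF r])
  have "act_Gamma_piece G (torelli_coset \<sigma>) r \<in> hom (?P r) (?P r)"
    using act_Gamma_piece_closed [OF \<sigma> _ r] act_Gamma_piece_mult [OF \<sigma> _ _ r] by (intro homI)
  moreover have "act_Gamma_piece G (torelli_coset \<sigma>) r \<one>\<^bsub>?P r\<^esub> = \<one>\<^bsub>?P r\<^esub>"
    using act_Gamma_piece_one [OF \<sigma> r] by (simp add: \<Gamma>.gr_piece_one)
  moreover have "(\<lambda>i. ?b i (r - i) (x i) (y (r - i))) \<in> {1..<r} \<rightarrow> carrier (?P r)"
    using \<Gamma>.gr_bracket_term_closed [OF x y] by auto
  ultimately have "act_Gamma_piece G (torelli_coset \<sigma>) r (finprod (?P r) (\<lambda>i. ?b i (r - i) (x i) (y (r - i))) {1..<r}) =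
      finprod (?P r) (\<lambda>i. act_Gamma_piece G (torelli_coset \<sigma>) r (?b i (r - i) (x i) (y (r - i)))) {1..<r}"
    by (rule hom_finprod [OF P.comm_monoid_axioms P.comm_monoid_axioms])
  also have "\<dots> = finprod (?P r) (\<lambda>i. ?b i (r - i) (act_Gamma G (torelli_coset \<sigma>) x i) (act_Gamma G (torelli_coset \<sigma>) y (r - i))) {1..<r}"
  proof (rule P.finprod_cong')
    fix i assume i: "i \<in> {1..<r}"
    then have i': "1 \<le> i" "1 \<le> r - i" "i + (r - i) = r" by auto
    then show "act_Gamma_piece G (torelli_coset \<sigma>) r (?b i (r - i) (x i) (y (r - i))) =
        ?b i (r - i) (act_Gamma G (torelli_coset \<sigma>) x i) (act_Gamma G (torelli_coset \<sigma>) y (r - i))"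
      using act_Gamma_piece_bracket [OF \<sigma> \<Gamma>.gr_component_carrier [OF x i'(1)]
          \<Gamma>.gr_component_carrier [OF y i'(2)] i'(1,2)]
      by (simp only: act_Gamma_apply [OF x i'(1)] act_Gamma_apply [OF y i'(2)])
  qed (use \<Gamma>.gr_bracket_term_closed [OF cl] in auto)
  finally show "act_Gamma G (torelli_coset \<sigma>) (lie_bracket (gr G (lower_central G)) x y) r =
      lie_bracket (gr G (lower_central G)) (act_Gamma G (torelli_coset \<sigma>) x) (act_Gamma G (torelli_coset \<sigma>) y) r"
    using r by (simp add: act_Gamma_apply [OF L.bracket_closed [OF x y] r]) (simp add: \<Gamma>.gr_bracket)
qed (auto intro: act_Gamma_closed L.bracket_closed x y)

lemma act_Gamma_component:
  assumes "x \<in> component (gr G (lower_central G)) t"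
  shows "act_Gamma G (torelli_coset \<sigma>) x \<in> component (gr G (lower_central G)) t"
  using assms act_Gamma_closed [of x] act_Gamma_piece_one [OF \<sigma>]
  by (simp add: \<Gamma>.gr_component act_Gamma_apply del: lower_central.simps)

lemma act_Gamma_one:
  "act_Gamma G (torelli_coset \<sigma>) \<one>\<^bsub>gr G (lower_central G)\<^esub> = \<one>\<^bsub>gr G (lower_central G)\<^esub>"
proof (rule \<Gamma>.gr_eqI)
  fix n :: nat assume n: "n \<ge> 1"
  then show "act_Gamma G (torelli_coset \<sigma>) \<one>\<^bsub>gr G (lower_central G)\<^esub> n = \<one>\<^bsub>gr G (lower_central G)\<^esub> n"
    using act_Gamma_piece_one [OF \<sigma> n] act_Gamma_apply [OF L.one_closed n]
    by (simp add: \<Gamma>.gr_one del: lower_central.simps)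
qed (auto intro: act_Gamma_closed)

end

lemma act_Gamma_comp:
  assumes \<sigma>: "\<sigma> \<in> carrier (AutoGroup G)" and \<tau>: "\<tau> \<in> carrier (AutoGroup G)"
    and x: "x \<in> carrier (gr G (lower_central G))"
  shows "act_Gamma G (torelli_coset (\<sigma> \<otimes>\<^bsub>AutoGroup G\<^esub> \<tau>)) x = act_Gamma G (torelli_coset \<sigma>) (act_Gamma G (torelli_coset \<tau>) x)"
proof (rule \<Gamma>.gr_eqI)
  fix n :: nat assume n: "n \<ge> 1"
  show "act_Gamma G (torelli_coset (\<sigma> \<otimes>\<^bsub>AutoGroup G\<^esub> \<tau>)) x n =
      act_Gamma G (torelli_coset \<sigma>) (act_Gamma G (torelli_coset \<tau>) x) n"
    using act_Gamma_piece_comp [OF \<sigma> \<tau> \<Gamma>.gr_component_carrier [OF x n] n]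
    by (simp only: act_Gamma_apply [OF x n] act_Gamma_apply [OF act_Gamma_closed [OF \<tau> x] n])
qed (use \<sigma> \<tau> x in \<open>auto intro!: act_Gamma_closed\<close>)

lemma act_Gamma_id:
  assumes x: "x \<in> carrier (gr G (lower_central G))"
  shows "act_Gamma G (torelli_coset \<one>\<^bsub>AutoGroup G\<^esub>) x = x"
proof (rule \<Gamma>.gr_eqI)
  fix n :: nat assume n: "n \<ge> 1"
  show "act_Gamma G (torelli_coset \<one>\<^bsub>AutoGroup G\<^esub>) x n = x n"
    using act_Gamma_piece_id [OF \<Gamma>.gr_component_carrier [OF x n] n] act_Gamma_apply [OF x n] by simp
qed (auto intro: act_Gamma_closed x)

section \<open>The action on the graded Torelli group\<close>

lemma act_Torelli_piece_coset:
  assumes \<sigma>: "\<sigma> \<in> carrier (AutoGroup G)" and \<alpha>: "\<alpha> \<in> johnson_filtration G s" and s: "s \<ge> 1"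
  shows "act_Torelli_piece G (torelli_coset \<sigma>) s (johnson_filtration G (Suc s) #>\<^bsub>AutoGroup G\<^esub> \<alpha>) =
    johnson_filtration G (Suc s) #>\<^bsub>AutoGroup G\<^esub>
      (\<sigma> \<otimes>\<^bsub>AutoGroup G\<^esub> \<alpha> \<otimes>\<^bsub>AutoGroup G\<^esub> inv\<^bsub>AutoGroup G\<^esub> \<sigma>)"
proof -
  let ?N = "johnson_filtration G (Suc s)"
  let ?c = "\<lambda>\<sigma> \<alpha>. \<sigma> \<otimes>\<^bsub>AutoGroup G\<^esub> \<alpha> \<otimes>\<^bsub>AutoGroup G\<^esub> inv\<^bsub>AutoGroup G\<^esub> \<sigma>"
  have *: "?N #>\<^bsub>AutoGroup G\<^esub> ?c \<sigma>' \<alpha>' = ?N #>\<^bsub>AutoGroup G\<^esub> ?c \<sigma> \<alpha>"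
    if \<sigma>': "\<sigma>' \<in> torelli_coset \<sigma>" and \<alpha>': "\<alpha>' \<in> ?N #>\<^bsub>AutoGroup G\<^esub> \<alpha>" for \<sigma>' \<alpha>'
  proof -
    obtain \<beta> where \<beta>: "\<beta> \<in> johnson_filtration G (Suc 0)" "\<sigma>' = \<beta> \<otimes>\<^bsub>AutoGroup G\<^esub> \<sigma>"
      using \<sigma>' by (auto simp: r_coset_def)
    obtain \<gamma> where \<gamma>: "\<gamma> \<in> ?N" "\<alpha>' = \<gamma> \<otimes>\<^bsub>AutoGroup G\<^esub> \<alpha>"
      using \<alpha>' unfolding r_coset_def by blast
    have [simp]: "\<alpha> \<in> carrier (AutoGroup G)" "\<beta> \<in> carrier (AutoGroup G)" "\<gamma> \<in> carrier (AutoGroup G)"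
      using \<alpha> \<beta> \<gamma> by auto
    note \<sigma> [simp]
    have \<alpha>'s: "\<alpha>' \<in> johnson_filtration G s"
      using \<alpha> \<gamma> F.Suc_subset by (auto intro!: F.series_mult_closed)
    have conj: "?c \<sigma> \<delta> \<in> johnson_filtration G n" if "\<delta> \<in> johnson_filtration G n" for \<delta> n
      by (rule F.normal_invE(2) [OF F.normal_series \<sigma> that])
    \<comment> \<open>Conjugation by \<beta> \<sigma> is conjugation by \<sigma> followed by
      conjugation by \<beta>, which isolates the Torelli factor \<beta>.\<close>
    have "?c \<sigma>' \<alpha>' = ?c \<beta> (?c \<sigma> \<alpha>')"
      by (simp add: \<beta> \<gamma> F.group_normalize)
    then have "?N #>\<^bsub>AutoGroup G\<^esub> ?c \<sigma>' \<alpha>' = ?N #>\<^bsub>AutoGroup G\<^esub> ?c \<beta> (?c \<sigma> \<alpha>')"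
      by simp
    \<comment> \<open>Here (F^1, F^s) in F^(s+1) enters: conjugation by \<beta> is trivial on F^s
      modulo F^(s+1).\<close>
    also have "\<dots> = ?N #>\<^bsub>AutoGroup G\<^esub> ?c \<sigma> \<alpha>'"
      by (rule F.coset_conj [OF \<beta>(1) conj [OF \<alpha>'s]]) (use s in auto)
    also have "?c \<sigma> \<alpha>' = ?c \<sigma> \<gamma> \<otimes>\<^bsub>AutoGroup G\<^esub> ?c \<sigma> \<alpha>"
      by (simp add: \<gamma> F.group_normalize)
    \<comment> \<open>The change \<gamma> of \<alpha> is absorbed because F^(s+1) is normal in the
      whole automorphism group.\<close>
    also have "?N #>\<^bsub>AutoGroup G\<^esub> \<dots> = ?N #>\<^bsub>AutoGroup G\<^esub> ?c \<sigma> \<alpha>"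
      using conj [OF \<gamma>(1)] by (subst F.coset_eq_iff) (simp_all add: F.group_normalize)
    finally show ?thesis .
  qed
  have "\<sigma> \<in> torelli_coset \<sigma>"
    using F.coset_nonempty [of \<sigma> 0] \<sigma> by (simp add: johnson_filtration_0)
  then show ?thesis
    unfolding act_Torelli_piece_def by (rule the_elem_image_pair [OF _ F.coset_nonempty [OF \<alpha>] *])
qed

lemma conj_johnson_filtration:
  "\<lbrakk>\<sigma> \<in> carrier (AutoGroup G); \<alpha> \<in> johnson_filtration G s\<rbrakk>
    \<Longrightarrow> \<sigma> \<otimes>\<^bsub>AutoGroup G\<^esub> \<alpha> \<otimes>\<^bsub>AutoGroup G\<^esub> inv\<^bsub>AutoGroup G\<^esub> \<sigma> \<in> johnson_filtration G s"
  by (rule F.normal_invE(2) [OF F.normal_series])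

lemma act_Torelli_apply:
  "\<lbrakk>a \<in> carrier (gr_Torelli G); s \<ge> 1\<rbrakk> \<Longrightarrow> act_Torelli G S a s = act_Torelli_piece G S s (a s)"
  by (simp add: act_Torelli_def act_Torelli_piece_def)

lemma Torelli_repr:
  assumes "a \<in> carrier (gr_Torelli G)" "s \<ge> 1"
  obtains \<alpha> where "\<alpha> \<in> johnson_filtration G s" "a s = johnson_filtration G (Suc s) #>\<^bsub>AutoGroup G\<^esub> \<alpha>"
  using F.gr_piece_repr_ex [OF F.gr_component_carrier, of a s] assms by (auto simp: Torelli_carrier)

lemma act_Torelli_closed:
  assumes \<sigma>: "\<sigma> \<in> carrier (AutoGroup G)" and a: "a \<in> carrier (gr_Torelli G)"
  shows "act_Torelli G (torelli_coset \<sigma>) a \<in> carrier (gr_Torelli G)"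
proof -
  obtain N where N: "\<forall>n>N. a n = johnson_filtration G (Suc n)"
    using F.gr_eventually_one a unfolding Torelli_carrier by blast
  show ?thesis
    unfolding Torelli_carrier
  proof (rule F.gr_carrierI [where N = N])
    show "act_Torelli G (torelli_coset \<sigma>) a \<in> extensional {1..}"
      using a by (simp add: act_Torelli_def)
  next
    fix s :: nat assume s: "s \<ge> 1"
    obtain \<alpha> where "\<alpha> \<in> johnson_filtration G s" "a s = johnson_filtration G (Suc s) #>\<^bsub>AutoGroup G\<^esub> \<alpha>"
      using Torelli_repr [OF a s] .
    then show "act_Torelli G (torelli_coset \<sigma>) a s \<in> carrier (gr_piece (AutoGroup G) (johnson_filtration G) s)"
      using \<sigma> s conj_johnson_filtration
      by (simp add: act_Torelli_apply [OF a s] act_Torelli_piece_coset F.coset_in_gr_piece)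
  next
    fix s assume "s > N"
    then show "act_Torelli G (torelli_coset \<sigma>) a s = johnson_filtration G (Suc s)"
      using act_Torelli_piece_coset [OF \<sigma> F.series_one_closed, of s] N \<sigma>
      by (simp add: act_Torelli_apply [OF a] F.coset_member)
  qed
qed

lemma Torelli_eqI:
  assumes "a \<in> carrier (gr_Torelli G)" "b \<in> carrier (gr_Torelli G)" "\<And>s. s \<ge> 1 \<Longrightarrow> a s = b s"
  shows "a = b"
  using assms F.gr_eqI unfolding Torelli_carrier by blast

lemma act_Torelli_group_action: "group_action (A_group G) (carrier (gr_Torelli G)) (act_Torelli G)"
proof (rule group_actionI)
  show "group (A_group G)" by (rule A_group)
  show "act_Torelli G S \<in> extensional (carrier (gr_Torelli G))" for S
    by (simp add: act_Torelli_def)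
  show "act_Torelli G S a \<in> carrier (gr_Torelli G)"
    if "S \<in> carrier (A_group G)" "a \<in> carrier (gr_Torelli G)" for S a
    using that act_Torelli_closed by (auto simp: A_group_carrier)
next
  fix a assume a: "a \<in> carrier (gr_Torelli G)"
  show "act_Torelli G \<one>\<^bsub>A_group G\<^esub> a = a"
    unfolding A_group_one
  proof (rule Torelli_eqI [OF act_Torelli_closed [OF F.one_closed a] a])
    fix s :: nat assume s: "s \<ge> 1"
    obtain \<alpha> where "\<alpha> \<in> johnson_filtration G s" "a s = johnson_filtration G (Suc s) #>\<^bsub>AutoGroup G\<^esub> \<alpha>"
      using Torelli_repr [OF a s] .
    then show "act_Torelli G (torelli_coset \<one>\<^bsub>AutoGroup G\<^esub>) a s = a s"
      using s by (simp add: act_Torelli_apply [OF a s] act_Torelli_piece_coset)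
  qed
next
  fix S T a
  assume "S \<in> carrier (A_group G)" "T \<in> carrier (A_group G)" and a: "a \<in> carrier (gr_Torelli G)"
  then obtain \<sigma> \<tau> where \<sigma>: "\<sigma> \<in> carrier (AutoGroup G)" "S = torelli_coset \<sigma>"
    and \<tau>: "\<tau> \<in> carrier (AutoGroup G)" "T = torelli_coset \<tau>"
    by (auto simp: A_group_carrier)
  have \<sigma>\<tau>: "\<sigma> \<otimes>\<^bsub>AutoGroup G\<^esub> \<tau> \<in> carrier (AutoGroup G)"
    using \<sigma> \<tau> by simp
  note \<tau>a = act_Torelli_closed [OF \<tau>(1) a]
  show "act_Torelli G (S \<otimes>\<^bsub>A_group G\<^esub> T) a = act_Torelli G S (act_Torelli G T a)"
    unfolding \<sigma>(2) \<tau>(2) A_group_mult [OF \<sigma>(1) \<tau>(1)]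
  proof (rule Torelli_eqI [OF act_Torelli_closed [OF \<sigma>\<tau> a] act_Torelli_closed [OF \<sigma>(1) \<tau>a]])
    fix s :: nat assume s: "s \<ge> 1"
    obtain \<alpha> where \<alpha>: "\<alpha> \<in> johnson_filtration G s" "a s = johnson_filtration G (Suc s) #>\<^bsub>AutoGroup G\<^esub> \<alpha>"
      using Torelli_repr [OF a s] .
    then show "act_Torelli G (torelli_coset (\<sigma> \<otimes>\<^bsub>AutoGroup G\<^esub> \<tau>)) a s =
        act_Torelli G (torelli_coset \<sigma>) (act_Torelli G (torelli_coset \<tau>) a) s"
      unfolding act_Torelli_apply [OF a s] act_Torelli_apply [OF \<tau>a s] \<alpha>(2)
        act_Torelli_piece_coset [OF \<sigma>\<tau> \<alpha>(1) s] act_Torelli_piece_coset [OF \<tau>(1) \<alpha>(1) s]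
        act_Torelli_piece_coset [OF \<sigma>(1) conj_johnson_filtration [OF \<tau>(1) \<alpha>(1)] s]
      using \<sigma>(1) \<tau>(1) by (simp add: F.m_assoc F.inv_mult_group)
  qed
qed

section \<open>The conjugation action on derivations\<close>

lemma act_Der_apply:
  assumes "\<sigma> \<in> carrier (AutoGroup G)" "\<delta> \<in> carrier (Der (gr_Gamma G))" "s \<ge> 1"
    and "x \<in> carrier (gr G (lower_central G))"
  shows "act_Der G (torelli_coset \<sigma>) \<delta> s x =
    act_Gamma G (torelli_coset \<sigma>) (\<delta> s (act_Gamma G (torelli_coset (inv\<^bsub>AutoGroup G\<^esub> \<sigma>)) x))"
  using assms by (simp add: act_Der_def A_group_inv) (simp add: gr_Gamma_def)

lemma DerD:
  assumes "\<delta> \<in> carrier (Der (gr_Gamma G))"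
  shows "s \<ge> 1 \<Longrightarrow> \<delta> s \<in> der_carrier (gr G (lower_central G)) s"
    and "finite {s \<in> {1..}. \<delta> s \<noteq> (\<lambda>x\<in>carrier (gr G (lower_central G)). \<one>\<^bsub>gr G (lower_central G)\<^esub>)}"
    and "\<delta> \<in> extensional {1..}"
  using assms by (auto simp: gr_Gamma_def L.Der_carrier PiE_iff)

lemma act_Gamma_inv:
  assumes \<sigma>: "\<sigma> \<in> carrier (AutoGroup G)" and x: "x \<in> carrier (gr G (lower_central G))"
  shows "act_Gamma G (torelli_coset \<sigma>) (act_Gamma G (torelli_coset (inv\<^bsub>AutoGroup G\<^esub> \<sigma>)) x) = x"
  using act_Gamma_comp [OF \<sigma> F.inv_closed [OF \<sigma>] x] act_Gamma_id [OF x] F.r_inv [OF \<sigma>] by simp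

text \<open>Conjugating a derivation by a graded Lie automorphism gives a derivation of the same
  degree. A zero component stays zero, which preserves finite support.\<close>

lemma act_Der_closed:
  assumes \<sigma>: "\<sigma> \<in> carrier (AutoGroup G)" and \<delta>: "\<delta> \<in> carrier (Der (gr_Gamma G))"
  shows "act_Der G (torelli_coset \<sigma>) \<delta> \<in> carrier (Der (gr_Gamma G))"
proof -
  let ?L = "gr G (lower_central G)"
  let ?\<sigma> = "act_Gamma G (torelli_coset \<sigma>)"
  let ?\<sigma>' = "act_Gamma G (torelli_coset (inv\<^bsub>AutoGroup G\<^esub> \<sigma>))"
  note \<sigma>' = F.inv_closed [OF \<sigma>]
  have ext: "act_Der G (torelli_coset \<sigma>) \<delta> s \<in> extensional (carrier ?L)" if "s \<ge> 1" for s
    using that \<delta> by (simp add: act_Der_def) (simp add: gr_Gamma_def)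
  have "act_Der G (torelli_coset \<sigma>) \<delta> s \<in> der_carrier ?L s" if s: "s \<ge> 1" for s
  proof (rule L.der_carrierI [OF ext [OF s]])
    note d = L.der_carrierD [OF DerD(1) [OF \<delta> s]]
    note apply' = act_Der_apply [OF \<sigma> \<delta> s]
    note cl = act_Gamma_closed [OF \<sigma>] act_Gamma_closed [OF \<sigma>'] d(1) L.bracket_closed
    show "act_Der G (torelli_coset \<sigma>) \<delta> s x \<in> carrier ?L" if "x \<in> carrier ?L" for x
      using that by (simp add: apply' cl)
    show "act_Der G (torelli_coset \<sigma>) \<delta> s (x \<otimes>\<^bsub>?L\<^esub> y) =
        act_Der G (torelli_coset \<sigma>) \<delta> s x \<otimes>\<^bsub>?L\<^esub> act_Der G (torelli_coset \<sigma>) \<delta> s y"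
      if "x \<in> carrier ?L" "y \<in> carrier ?L" for x y
      using that by (simp add: apply' cl act_Gamma_mult [OF \<sigma>] act_Gamma_mult [OF \<sigma>'] d(2))
    show "act_Der G (torelli_coset \<sigma>) \<delta> s x \<in> component ?L (t + s)"
      if "x \<in> component ?L t" "t \<ge> 1" for x t
      using act_Gamma_component [OF \<sigma> d(3) [OF act_Gamma_component [OF \<sigma>' that(1)] that(2)]] that
      by (simp add: apply' \<Gamma>.gr_component)
    \<comment> \<open>In each term of the Leibniz rule the argument untouched by the derivation
      receives \<sigma>^-1 and then \<sigma>; \<open>act_Gamma_inv\<close> removes the pair.\<close>
    show "act_Der G (torelli_coset \<sigma>) \<delta> s (lie_bracket ?L x y) =
        lie_bracket ?L (act_Der G (torelli_coset \<sigma>) \<delta> s x) y \<otimes>\<^bsub>?L\<^esub>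
        lie_bracket ?L x (act_Der G (torelli_coset \<sigma>) \<delta> s y)"
      if "x \<in> carrier ?L" "y \<in> carrier ?L" for x y
      using that
      by (simp add: apply' cl act_Gamma_mult [OF \<sigma>] act_Gamma_bracket [OF \<sigma>]
          act_Gamma_bracket [OF \<sigma>'] d(4) act_Gamma_inv [OF \<sigma>])
  qed
  moreover have "act_Der G (torelli_coset \<sigma>) \<delta> s = (\<lambda>x\<in>carrier ?L. \<one>\<^bsub>?L\<^esub>)"
    if s: "s \<ge> 1" and "\<delta> s = (\<lambda>x\<in>carrier ?L. \<one>\<^bsub>?L\<^esub>)" for s
    using that act_Gamma_closed [OF \<sigma>'] act_Gamma_one [OF \<sigma>]
    by (intro extensionalityI [OF ext [OF s]]) (auto simp: act_Der_apply [OF \<sigma> \<delta> s])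
  then have "{s \<in> {1..}. act_Der G (torelli_coset \<sigma>) \<delta> s \<noteq> (\<lambda>x\<in>carrier ?L. \<one>\<^bsub>?L\<^esub>)} \<subseteq>
      {s \<in> {1..}. \<delta> s \<noteq> (\<lambda>x\<in>carrier ?L. \<one>\<^bsub>?L\<^esub>)}"
    by blast
  then have "finite {s \<in> {1..}. act_Der G (torelli_coset \<sigma>) \<delta> s \<noteq> (\<lambda>x\<in>carrier ?L. \<one>\<^bsub>?L\<^esub>)}"
    using DerD(2) [OF \<delta>] by (rule finite_subset)
  moreover have "act_Der G (torelli_coset \<sigma>) \<delta> \<in> extensional {1..}"
    using \<delta> by (simp add: act_Der_def)
  ultimately show ?thesis
    by (simp add: gr_Gamma_def L.Der_carrier PiE_iff)
qed

lemma Der_eqI: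
  assumes "\<delta> \<in> carrier (Der (gr_Gamma G))" "\<epsilon> \<in> carrier (Der (gr_Gamma G))"
    and "\<And>s x. \<lbrakk>s \<ge> 1; x \<in> carrier (gr G (lower_central G))\<rbrakk> \<Longrightarrow> \<delta> s x = \<epsilon> s x"
  shows "\<delta> = \<epsilon>"
proof (rule extensionalityI [OF DerD(3) [OF assms(1)] DerD(3) [OF assms(2)]])
  fix s :: nat assume "s \<in> {1..}"
  then have s: "s \<ge> 1" by simp
  show "\<delta> s = \<epsilon> s"
    using assms(3) [OF s]
    by (rule extensionalityI [OF L.der_carrierD(5) [OF DerD(1) [OF assms(1) s]]
          L.der_carrierD(5) [OF DerD(1) [OF assms(2) s]]])
qed

lemma act_Der_group_action: "group_action (A_group G) (carrier (Der (gr_Gamma G))) (act_Der G)"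
proof (rule group_actionI)
  show "group (A_group G)" by (rule A_group)
  show "act_Der G S \<in> extensional (carrier (Der (gr_Gamma G)))" for S
    by (simp add: act_Der_def)
  show "act_Der G S \<delta> \<in> carrier (Der (gr_Gamma G))"
    if "S \<in> carrier (A_group G)" "\<delta> \<in> carrier (Der (gr_Gamma G))" for S \<delta>
    using that act_Der_closed by (auto simp: A_group_carrier)
next
  fix \<delta> assume \<delta>: "\<delta> \<in> carrier (Der (gr_Gamma G))"
  show "act_Der G \<one>\<^bsub>A_group G\<^esub> \<delta> = \<delta>"
    unfolding A_group_one
  proof (rule Der_eqI [OF act_Der_closed [OF F.one_closed \<delta>] \<delta>])
    fix s :: nat and x assume s: "s \<ge> 1" and x: "x \<in> carrier (gr G (lower_central G))"
    then show "act_Der G (torelli_coset \<one>\<^bsub>AutoGroup G\<^esub>) \<delta> s x = \<delta> s x"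
      using L.der_carrierD(1) [OF DerD(1) [OF \<delta> s] x]
      by (simp add: act_Der_apply [OF F.one_closed \<delta> s x] act_Gamma_id)
  qed
next
  fix S T \<delta>
  assume "S \<in> carrier (A_group G)" "T \<in> carrier (A_group G)" and \<delta>: "\<delta> \<in> carrier (Der (gr_Gamma G))"
  then obtain \<sigma> \<tau> where \<sigma>: "\<sigma> \<in> carrier (AutoGroup G)" "S = torelli_coset \<sigma>"
    and \<tau>: "\<tau> \<in> carrier (AutoGroup G)" "T = torelli_coset \<tau>"
    by (auto simp: A_group_carrier)
  have \<sigma>\<tau>: "\<sigma> \<otimes>\<^bsub>AutoGroup G\<^esub> \<tau> \<in> carrier (AutoGroup G)"
    using \<sigma> \<tau> by simp
  note \<tau>\<delta> = act_Der_closed [OF \<tau>(1) \<delta>]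
  show "act_Der G (S \<otimes>\<^bsub>A_group G\<^esub> T) \<delta> = act_Der G S (act_Der G T \<delta>)"
    unfolding \<sigma>(2) \<tau>(2) A_group_mult [OF \<sigma>(1) \<tau>(1)]
  proof (rule Der_eqI [OF act_Der_closed [OF \<sigma>\<tau> \<delta>] act_Der_closed [OF \<sigma>(1) \<tau>\<delta>]])
    fix s :: nat and x assume s: "s \<ge> 1" and x: "x \<in> carrier (gr G (lower_central G))"
    note \<sigma>x = act_Gamma_closed [OF F.inv_closed [OF \<sigma>(1)] x]
    have "\<delta> s (act_Gamma G (torelli_coset (inv\<^bsub>AutoGroup G\<^esub> \<tau>))
        (act_Gamma G (torelli_coset (inv\<^bsub>AutoGroup G\<^esub> \<sigma>)) x)) \<in> carrier (gr G (lower_central G))"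
      by (intro L.der_carrierD(1) [OF DerD(1) [OF \<delta> s]] act_Gamma_closed F.inv_closed \<sigma> \<tau> x)
    then show "act_Der G (torelli_coset (\<sigma> \<otimes>\<^bsub>AutoGroup G\<^esub> \<tau>)) \<delta> s x =
        act_Der G (torelli_coset \<sigma>) (act_Der G (torelli_coset \<tau>) \<delta>) s x"
      unfolding act_Der_apply [OF \<sigma>\<tau> \<delta> s x] act_Der_apply [OF \<sigma>(1) \<tau>\<delta> s x]
        act_Der_apply [OF \<tau>(1) \<delta> s \<sigma>x]
      using \<sigma>(1) \<tau>(1) x by (simp add: F.inv_mult_group act_Gamma_comp)
  qed
qed

section \<open>Equivariance, first on cosets and then on the direct sum\<close>

lemma johnson_piece_equivariant:
  assumes \<sigma>: "\<sigma> \<in> carrier (AutoGroup G)"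
    and A: "A \<in> carrier (gr_piece (AutoGroup G) (johnson_filtration G) s)"
    and X: "X \<in> carrier (gr_piece G (lower_central G) t)" and s: "s \<ge> 1" and t: "t \<ge> 1"
  shows "johnson_piece G s t (act_Torelli_piece G (torelli_coset \<sigma>) s A) X =
    act_Gamma_piece G (torelli_coset \<sigma>) (s + t)
      (johnson_piece G s t A (act_Gamma_piece G (torelli_coset (inv\<^bsub>AutoGroup G\<^esub> \<sigma>)) t X))"
proof -
  obtain \<alpha> where \<alpha>: "\<alpha> \<in> johnson_filtration G s" "A = johnson_filtration G (Suc s) #>\<^bsub>AutoGroup G\<^esub> \<alpha>"
    using F.gr_piece_repr_ex [OF A] .
  obtain x where x: "x \<in> lower_central G t" "X = lower_central G (Suc t) #> x"
    using \<Gamma>.gr_piece_repr_ex [OF X] .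
  define y where "y = (inv\<^bsub>AutoGroup G\<^esub> \<sigma>) x"
  have y: "y \<in> lower_central G t"
    unfolding y_def by (rule AutoGroup_lower_central [OF F.inv_closed [OF \<sigma>] x(1)])
  have \<alpha>A: "\<alpha> \<in> carrier (AutoGroup G)" using \<alpha> by simp
  have xG: "x \<in> carrier G" and yG: "y \<in> carrier G" using x y by auto
  have st: "s + t \<ge> 1" using t by simp
  let ?c = "\<sigma> \<otimes>\<^bsub>AutoGroup G\<^esub> \<alpha> \<otimes>\<^bsub>AutoGroup G\<^esub> inv\<^bsub>AutoGroup G\<^esub> \<sigma>"
  have "?c x \<otimes> inv x = \<sigma> (\<alpha> y) \<otimes> inv (\<sigma> y)"
    using \<sigma> \<alpha>A xG yG by (simp add: y_def)
  also have "\<dots> = \<sigma> (\<alpha> y \<otimes> inv y)"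
    using \<sigma> yG AutoGroup_closed [OF \<alpha>A yG] by (simp add: AutoGroup_mult AutoGroup_inv)
  finally have eq: "?c x \<otimes> inv x = \<sigma> (\<alpha> y \<otimes> inv y)" .
  \<comment> \<open>Each unfolded rule evaluates an induced map at the chosen representatives; with
    \<open>eq\<close> the two sides become literally the same coset.\<close>
  show ?thesis
    unfolding \<alpha>(2) x(2) act_Torelli_piece_coset [OF \<sigma> \<alpha>(1) s]
      act_Gamma_piece_coset [OF F.inv_closed [OF \<sigma>] x(1) t] y_def [symmetric]
      johnson_piece_coset [OF \<alpha>(1) y t]
      johnson_piece_coset [OF conj_johnson_filtration [OF \<sigma> \<alpha>(1)] x(1) t]
      act_Gamma_piece_coset [OF \<sigma> johnson_filtration_lower_central [OF \<alpha>(1) y t] st] eq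
    by (rule refl)
qed

lemma johnson_equivariant:
  assumes \<sigma>: "\<sigma> \<in> carrier (AutoGroup G)" and a: "a \<in> carrier (gr_Torelli G)"
  shows "johnson G (act_Torelli G (torelli_coset \<sigma>) a) = act_Der G (torelli_coset \<sigma>) (johnson G a)"
proof (rule Der_eqI)
  note \<sigma>a = act_Torelli_closed [OF \<sigma> a]
  show "johnson G (act_Torelli G (torelli_coset \<sigma>) a) \<in> carrier (Der (gr_Gamma G))"
    by (rule johnson_closed [OF \<sigma>a])
  show "act_Der G (torelli_coset \<sigma>) (johnson G a) \<in> carrier (Der (gr_Gamma G))"
    by (rule act_Der_closed [OF \<sigma> johnson_closed [OF a]])
  fix s :: nat and x assume s: "s \<ge> 1" and x: "x \<in> carrier (gr G (lower_central G))"
  let ?\<sigma>' = "act_Gamma G (torelli_coset (inv\<^bsub>AutoGroup G\<^esub> \<sigma>))"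
  have \<sigma>'x: "?\<sigma>' x \<in> carrier (gr G (lower_central G))"
    by (rule act_Gamma_closed [OF F.inv_closed [OF \<sigma>] x])
  have as: "a s \<in> carrier (gr_piece (AutoGroup G) (johnson_filtration G) s)"
    and \<sigma>as: "act_Torelli G (torelli_coset \<sigma>) a s \<in> carrier (gr_piece (AutoGroup G) (johnson_filtration G) s)"
    using a \<sigma>a s F.gr_component_carrier by (auto simp: Torelli_carrier)
  have Jx: "johnson_degree G s (a s) (?\<sigma>' x) \<in> carrier (gr G (lower_central G))"
    by (rule johnson_degree_closed [OF as \<sigma>'x])
  have "johnson_degree G s (act_Torelli G (torelli_coset \<sigma>) a s) x =
      act_Gamma G (torelli_coset \<sigma>) (johnson_degree G s (a s) (?\<sigma>' x))"
  proof (rule \<Gamma>.gr_eqI [OF johnson_degree_closed [OF \<sigma>as x] act_Gamma_closed [OF \<sigma> Jx]])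
    fix r :: nat assume r: "r \<ge> 1"
    show "johnson_degree G s (act_Torelli G (torelli_coset \<sigma>) a s) x r =
        act_Gamma G (torelli_coset \<sigma>) (johnson_degree G s (a s) (?\<sigma>' x)) r"
    proof (cases "s < r")
      case True
      then have rs: "1 \<le> r - s" "s + (r - s) = r" by auto
      show ?thesis
        using True johnson_piece_equivariant [OF \<sigma> as \<Gamma>.gr_component_carrier [OF x rs(1)] s rs(1)]
        unfolding act_Gamma_apply [OF Jx r] johnson_degree_apply [OF x r]
          johnson_degree_apply [OF \<sigma>'x r] act_Torelli_apply [OF a s] act_Gamma_apply [OF x rs(1)] rs(2)
        by simp
    next
      \<comment> \<open>In degrees r at most s the Johnson map is zero by definition, and the action
        fixes zero.\<close>
      case False
      then show ?thesis
        unfolding act_Gamma_apply [OF Jx r] johnson_degree_apply [OF x r] johnson_degree_apply [OF \<sigma>'x r]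
        using act_Gamma_piece_one [OF \<sigma> r] by simp
    qed
  qed
  then show "johnson G (act_Torelli G (torelli_coset \<sigma>) a) s x =
      act_Der G (torelli_coset \<sigma>) (johnson G a) s x"
    unfolding act_Der_apply [OF \<sigma> johnson_closed [OF a] s x]
    using s a \<sigma>a by (simp add: johnson_def)
qed

end

theorem proposition2p6:
  fixes G :: "('a, 'b) monoid_scheme"
  assumes "group G"
  shows "equivariant_map (A_group G)
           (carrier (gr_Torelli G)) (act_Torelli G)
           (carrier (Der (gr_Gamma G))) (act_Der G)
           (johnson G)"
proof -
  interpret group G by fact
  show ?thesis
    unfolding equivariant_map_def
    using act_Torelli_group_action act_Der_group_action johnson_closed johnson_equivariant
    \<comment> \<open>Writes an arbitrary element of \<open>A_group G\<close> as the coset of an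
      automorphism, the form in which \<open>johnson_equivariant\<close> is stated.\<close>
    by (auto simp: A_group_carrier)
qed

end
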